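(* Let $q\in(-1,1)$, let $W^{(q)}=\{W^{(q)}_t\}_{t\ge0}$ be the $q$-Brownian motion, let $s>0$, and let $x_-=-2\sqrt{\frac{s}{1-q}}$ be the left end-point of the support of $W^{(q)}_s$. For $\epsilon>0$ put $$\widetilde V^{(\epsilon,s)}_t:=\frac{W^{(q)}_{s+t\epsilon}+a\,t\epsilon-W^{(q)}_s}{\epsilon^2},\quad t\ge0,\qquad\text{with}\quad a=-\frac{2}{(1-q)x_-}=\frac{1}{\sqrt{s(1-q)}}.$$ Then, under the law $\mathbb{P}(\cdot\mid W^{(q)}_s=x_-)$, as $\epsilon\downarrow0$, the finite-dimensional distributions of $\{\widetilde V^{(\epsilon,s)}_t\}_{t\ge0}$ converge weakly to those of $$\frac{1}{s^{3/2}\sqrt{1-q}}\left\{\mathbb{Z}^{(1/2)}_t\right\}_{t\ge0},$$ where $\mathbb{Z}^{(1/2)}$ is the $1/2$-stable Biane process.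
   Context: The $q$-Brownian motion $W^{(q)}=\{W^{(q)}_t\}_{t\ge0}$, $q\in(-1,1)$, is the càdlàg Markov process starting from $0$, whose support at time $t$ is $[-2\sqrt{t/(1-q)},2\sqrt{t/(1-q)}]$, and whose transition probability density from $y_1$ at time $t_1$ to $y_2$ at time $t_2>t_1$ (with $y_i$ in the support at time $t_i$) is $$\kappa^{(q)}_{t_1,t_2}(y_1,y_2)=\frac{(1-q)^{3/2}(t_2-t_1)}{2\pi}\,\frac{\sqrt{4t_2-(1-q)y_2^2}}{\varphi^*_{q,0}(t_1,t_2,y_1,y_2)}\prod_{k=1}^\infty\frac{\psi^*_{q,k}(t_1,t_2,y_2)}{\varphi^*_{q,k}(t_1,t_2,y_1,y_2)},$$ where, for $k\ge1$, $$\psi^*_{q,k}(t_1,t_2,y_2)=(t_2-t_1q^k)(1-q^{k+1})\left[t_2(1+q^k)^2-(1-q)y_2^2q^k\right]$$ and, for $k\ge0$ (with $q^0=1$, also for $q=0$), $$\varphi^*_{q,k}(t_1,t_2,y_1,y_2)=(t_2-t_1q^{2k})^2-(1-q)q^k(t_2+t_1q^{2k})y_1y_2+(1-q)(t_1y_2^2+t_2y_1^2)q^{2k}.$$ $\mathbb{P}(\cdot\mid W^{(q)}_s=x)$ denotes the law of the Markov process $\{W^{(q)}_t\}_{t\ge s}$ started at $x$ at time $s$ with these transition densities (the end-points of the support at time $s$ are allowed as starting points). The $1/2$-stable Biane process $\mathbb{Z}^{(1/2)}=\{\mathbb{Z}^{(1/2)}_t\}_{t\ge0}$ is the Markov process starting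 from $0$ at time $0$, with support $[t^2/4,\infty)$ at time $t$, and with transition probability density $$f^{(1/2)}_{t_1,t_2}(y_1,y_2)=\frac{(t_2-t_1)\sqrt{4y_2-t_2^2}}{2\pi\left[(y_2-y_1)^2-(t_2-t_1)(t_1y_2-t_2y_1)\right]},\quad 0\le t_1<t_2<\infty,\ y_1>\frac{t_1^2}{4},\ y_2>\frac{t_2^2}{4};$$ its marginal law at time $t>0$ has density $\frac{t\sqrt{4x-t^2}}{2\pi x^2}$ on $(t^2/4,\infty)$ (the same formula with $t_1=0$, $y_1=0$). *)

theory Defs
  imports "HOL-Probability.Probability"
begin

subsection \<open>Markov processes given by transition densities\<close>

definition natural_filtration ::
  "'a measure \<Rightarrow> (real \<Rightarrow> 'a \<Rightarrow> real) \<Rightarrow> real \<Rightarrow> real \<Rightarrow> 'a measure" where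
  "natural_filtration M X s t =
     sigma (space M) {X u -` A \<inter> space M | u A. s \<le> u \<and> u \<le> t \<and> A \<in> sets borel}"

text \<open>The process runs over the times \<open>t \<ge> s\<close>; the values \<open>X t\<close> with \<open>t < s\<close> play no role.
  The last clause is the Markov property: the conditional probability of \<open>{X t2 \<in> A}\<close> given the
  past up to time \<open>t1\<close> is the integral over \<open>A\<close> of the transition density \<open>p t1 t2 (X t1)\<close>.\<close>

definition markov_process_from ::
  "(real \<Rightarrow> real \<Rightarrow> real \<Rightarrow> real \<Rightarrow> real) \<Rightarrow> real \<Rightarrow> real \<Rightarrow> 'a measure
     \<Rightarrow> (real \<Rightarrow> 'a \<Rightarrow> real) \<Rightarrow> bool" where
  "markov_process_from p s x M X \<longleftrightarrow>
     prob_space M \<and>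
     (\<forall>t\<ge>s. X t \<in> borel_measurable M) \<and>
     (AE \<omega> in M. X s \<omega> = x) \<and>
     (\<forall>t1 t2. \<forall>A\<in>sets borel. s \<le> t1 \<and> t1 < t2 \<longrightarrow>
        (AE \<omega> in M. nn_cond_exp M (natural_filtration M X s t1)
                        (indicator (X t2 -` A \<inter> space M)) \<omega>
                    = (\<integral>\<^sup>+ y\<in>A. ennreal (p t1 t2 (X t1 \<omega>) y) \<partial>lborel)))"

definition cadlag_from :: "real \<Rightarrow> (real \<Rightarrow> real) \<Rightarrow> bool" where
  "cadlag_from s f \<longleftrightarrow>
     (\<forall>t\<ge>s. (f \<longlongrightarrow> f t) (at_right t)) \<and> (\<forall>t>s. \<exists>l. (f \<longlongrightarrow> l) (at_left t))"

subsection \<open>The q-Brownian motion\<close>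

definition qBM_support :: "real \<Rightarrow> real \<Rightarrow> real set" where
  "qBM_support q t = {- 2 * sqrt (t / (1 - q)) .. 2 * sqrt (t / (1 - q))}"

definition psi_star :: "real \<Rightarrow> nat \<Rightarrow> real \<Rightarrow> real \<Rightarrow> real \<Rightarrow> real" where
  "psi_star q k t1 t2 y2 =
     (t2 - t1 * q ^ k) * (1 - q ^ (k + 1)) * (t2 * (1 + q ^ k)\<^sup>2 - (1 - q) * y2\<^sup>2 * q ^ k)"

definition phi_star :: "real \<Rightarrow> nat \<Rightarrow> real \<Rightarrow> real \<Rightarrow> real \<Rightarrow> real \<Rightarrow> real" where
  "phi_star q k t1 t2 y1 y2 =
     (t2 - t1 * q ^ (2 * k))\<^sup>2 - (1 - q) * q ^ k * (t2 + t1 * q ^ (2 * k)) * y1 * y2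
     + (1 - q) * (t1 * y2\<^sup>2 + t2 * y1\<^sup>2) * q ^ (2 * k)"

text \<open>The density is extended by \<open>0\<close> to \<open>y2\<close> outside the support at time \<open>t2\<close>. The values for
  \<open>y1\<close> outside the support at time \<open>t1\<close> are irrelevant.\<close>

definition qBM_density :: "real \<Rightarrow> real \<Rightarrow> real \<Rightarrow> real \<Rightarrow> real \<Rightarrow> real" where
  "qBM_density q t1 t2 y1 y2 =
     (if y2 \<in> qBM_support q t2
      then (1 - q) powr (3/2) * (t2 - t1) / (2 * pi)
           * (sqrt (4 * t2 - (1 - q) * y2\<^sup>2) / phi_star q 0 t1 t2 y1 y2)
           * (\<Prod>k. psi_star q (Suc k) t1 t2 y2 / phi_star q (Suc k) t1 t2 y1 y2)
      else 0)"

text \<open>\<open>W\<close> is distributed according to the law of the q-Brownian motion started at \<open>x\<close> at time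
  \<open>s\<close>, i.e. the law written \<open>P(. | W\<^sub>s = x)\<close>; \<open>s = 0\<close>, \<open>x = 0\<close> is the q-Brownian motion itself.
  Conditioning on \<open>W\<^sub>s = x\<close> has to be understood in this way because the event is null.\<close>

definition q_Brownian_motion_from ::
  "real \<Rightarrow> real \<Rightarrow> real \<Rightarrow> 'a measure \<Rightarrow> (real \<Rightarrow> 'a \<Rightarrow> real) \<Rightarrow> bool" where
  "q_Brownian_motion_from q s x M W \<longleftrightarrow>
     markov_process_from (qBM_density q) s x M W \<and>
     (AE \<omega> in M. cadlag_from s (\<lambda>t. W t \<omega>))"

subsection \<open>The 1/2-stable Biane process\<close>

text \<open>As above, extended by \<open>0\<close> to \<open>y2\<close> outside the support at time \<open>t2\<close>. No
  condition on \<open>y1\<close> is built in, so that \<open>t1 = 0\<close>, \<open>y1 = 0\<close> gives the marginal density.\<close>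

definition biane_density :: "real \<Rightarrow> real \<Rightarrow> real \<Rightarrow> real \<Rightarrow> real" where
  "biane_density t1 t2 y1 y2 =
     (if y2 > t2\<^sup>2 / 4
      then (t2 - t1) * sqrt (4 * y2 - t2\<^sup>2)
           / (2 * pi * ((y2 - y1)\<^sup>2 - (t2 - t1) * (t1 * y2 - t2 * y1)))
      else 0)"

definition biane_process :: "'a measure \<Rightarrow> (real \<Rightarrow> 'a \<Rightarrow> real) \<Rightarrow> bool" where
  "biane_process M Z \<longleftrightarrow> markov_process_from biane_density 0 0 M Z"

subsection \<open>Weak convergence of finite-dimensional distributions\<close>

definition fin_dim_distr ::
  "'a measure \<Rightarrow> (real \<Rightarrow> 'a \<Rightarrow> real) \<Rightarrow> real ^ 'n \<Rightarrow> (real ^ 'n) measure" where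
  "fin_dim_distr M X t = distr M borel (\<lambda>\<omega>. \<chi> i. X (t $ i) \<omega>)"

definition weakly_converges ::
  "('i \<Rightarrow> 'b::topological_space measure) \<Rightarrow> 'b measure \<Rightarrow> 'i filter \<Rightarrow> bool" where
  "weakly_converges \<mu> \<nu> F \<longleftrightarrow>
     (\<forall>f :: 'b \<Rightarrow> real. continuous_on UNIV f \<and> bounded (range f) \<longrightarrow>
        ((\<lambda>i. integral\<^sup>L (\<mu> i) f) \<longlongrightarrow> integral\<^sup>L \<nu> f) F)"

definition V_tilde ::
  "real \<Rightarrow> real \<Rightarrow> (real \<Rightarrow> 'a \<Rightarrow> real) \<Rightarrow> real \<Rightarrow> real \<Rightarrow> 'a \<Rightarrow> real" where
  "V_tilde s a W \<epsilon> t \<omega> = (W (s + t * \<epsilon>) \<omega> + a * t * \<epsilon> - W s \<omega>) / \<epsilon>\<^sup>2"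

end

theory Submission
  imports Defs
begin

text \<open>
  The convergence takes place already at the level of densities. Started at the left end-point
  \<open>x_minus = - 2 * s * a\<close> at time \<open>s\<close>, the process
  \<open>Y u = (W (s + u * e) - x_minus + a * u * e) / (a / s * e\<^sup>2)\<close> is a Markov process that starts
  at \<open>0\<close>; its transition densities are those of the q-Brownian motion under an affine change of
  time and space (\<open>markov_process_affine\<close>). As \<open>e\<close> tends to \<open>0\<close>, these densities
  converge to the Biane densities wherever the latter are positive
  (\<open>qBM_density_rescaled_tendsto\<close>). The factors with
  \<open>k = 0\<close> are responsible for the shape of the limit: \<open>phi_star q 0\<close> is of order
  \<open>e ^ 4\<close> and its leading coefficient is a multiple of the polynomial in the denominator of the
  Biane density, while the radicand \<open>4 * t2 - (1 - q) * y2\<^sup>2\<close> is of order \<open>e\<^sup>2\<close> with leading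
  coefficient \<open>(4 * z2 - u2\<^sup>2) / s\<close>. The remaining infinite product is continuous at the
  end-point and contributes only the constant \<open>1 / (1 - q)\<close>, the value of a telescoping product
  (\<open>qBM_product_tendsto\<close>).

  The passage from densities to finite-dimensional distributions is Scheffe's argument. By the Markov
  property the joint law at finitely many times has the product of the transition densities as its
  density with respect to a product measure (\<open>markov_process_joint_distr\<close>). The products
  converge pointwise wherever the limit is positive, and they all have mass \<open>1\<close>, because they
  are joint densities of existing processes. No mass can be lost, and the joint densities converge in
  \<open>L\<^sup>1\<close> (\<open>integral_tendsto_of_densities_from_below\<close>). In particular the integrals of
  bounded continuous functions converge.
\<close>

section \<open>Transition densities determine the joint laws of a Markov process\<close>

lemma subalgebra_natural_filtration:
  assumes "\<And>u. s \<le> u \<Longrightarrow> X u \<in> borel_measurable M"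
  shows "subalgebra M (natural_filtration M X s t)"
proof -
  have *: "{X u -` A \<inter> space M | u A. s \<le> u \<and> u \<le> t \<and> A \<in> sets borel} \<subseteq> sets M"
    using assms by (auto intro: measurable_sets)
  then have "{X u -` A \<inter> space M | u A. s \<le> u \<and> u \<le> t \<and> A \<in> sets borel} \<subseteq> Pow (space M)"
    by auto
  with * show ?thesis
    unfolding subalgebra_def natural_filtration_def
    by (auto simp: space_measure_of_conv sets_measure_of sets.sigma_sets_subset
        dest: sets.sigma_sets_subset[THEN subsetD])
qed

lemma space_natural_filtration [simp]: "space (natural_filtration M X s t) = space M"
  by (simp add: natural_filtration_def space_measure_of_conv)

lemma measurable_natural_filtration:
  assumes "s \<le> u" "u \<le> t"
  shows "X u \<in> borel_measurable (natural_filtration M X s t)"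
proof (rule measurableI)
  fix A :: "real set" assume "A \<in> sets borel"
  then show "X u -` A \<inter> space (natural_filtration M X s t) \<in> sets (natural_filtration M X s t)"
    unfolding space_natural_filtration unfolding natural_filtration_def
    using assms by (subst sets_measure_of) (auto intro!: sigma_sets.Basic)
qed auto

text \<open>The Markov property in integrated form: conditioning is removed by integrating over an event
  \<open>B\<close> of the past. This is the only form in which conditional expectations enter.\<close>

lemma markov_process_one_step:
  assumes X: "markov_process_from p s x M X" and t: "s \<le> t1" "t1 < t2"
    and B: "B \<in> sets (natural_filtration M X s t1)" and A: "A \<in> sets borel"
  shows "emeasure M (B \<inter> (X t2 -` A \<inter> space M)) =
    (\<integral>\<^sup>+\<omega>. indicator B \<omega> * (\<integral>\<^sup>+y\<in>A. ennreal (p t1 t2 (X t1 \<omega>) y) \<partial>lborel) \<partial>M)"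
proof -
  define F where "F = natural_filtration M X s t1"
  have meas: "X u \<in> borel_measurable M" if "s \<le> u" for u
    using X that by (auto simp: markov_process_from_def)
  have sub: "subalgebra M F"
    unfolding F_def using meas by (rule subalgebra_natural_filtration)
  interpret prob_space M using X by (simp add: markov_process_from_def)
  interpret finite_measure_subalgebra M F
    by unfold_locales (rule sub)
  have AE: "AE \<omega> in M. nn_cond_exp M F (indicator (X t2 -` A \<inter> space M)) \<omega>
                    = (\<integral>\<^sup>+ y\<in>A. ennreal (p t1 t2 (X t1 \<omega>) y) \<partial>lborel)"
    using X t A unfolding F_def markov_process_from_def by blast
  have A': "X t2 -` A \<inter> space M \<in> sets M"
    using meas[of t2] t A by (auto intro: measurable_sets)
  have B': "B \<in> sets M"
    using B sub by (auto simp: F_def subalgebra_def)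
  have "(\<integral>\<^sup>+\<omega>. indicator B \<omega> * (\<integral>\<^sup>+y\<in>A. ennreal (p t1 t2 (X t1 \<omega>) y) \<partial>lborel) \<partial>M)
    = (\<integral>\<^sup>+\<omega>. indicator B \<omega> * nn_cond_exp M F (indicator (X t2 -` A \<inter> space M)) \<omega> \<partial>M)"
    using AE by (intro nn_integral_cong_AE) auto
  also have "\<dots> = (\<integral>\<^sup>+\<omega>. indicator B \<omega> * indicator (X t2 -` A \<inter> space M) \<omega> \<partial>M)"
    using B A' by (intro nn_cond_exp_intg) (auto simp: F_def)
  also have "\<dots> = (\<integral>\<^sup>+\<omega>. indicator (B \<inter> (X t2 -` A \<inter> space M)) \<omega> \<partial>M)"
    by (simp add: indicator_inter_arith)
  also have "\<dots> = emeasure M (B \<inter> (X t2 -` A \<inter> space M))"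
    using A' B' by simp
  finally show ?thesis ..
qed

text \<open>The Markov property constrains a transition density only through integrals along the paths
  of one process, which gives no measurability in the starting point. Joint measurability is what
  makes products of transition densities integrable kernels.\<close>

definition borel_transition :: "real \<Rightarrow> (real \<Rightarrow> real \<Rightarrow> real \<Rightarrow> real \<Rightarrow> real) \<Rightarrow> bool" where
  "borel_transition s p \<longleftrightarrow>
     (\<forall>t1\<ge>s. \<forall>t2>t1. case_prod (p t1 t2) \<in> borel_measurable (borel \<Otimes>\<^sub>M borel))"

lemma borel_transitionD:
  "borel_transition s p \<Longrightarrow> s \<le> t1 \<Longrightarrow> t1 < t2 \<Longrightarrow>
     case_prod (p t1 t2) \<in> borel_measurable (borel \<Otimes>\<^sub>M borel)"
  by (simp add: borel_transition_def)

text \<open>The finite set of times itself serves as index set of a path, so that repeated and unordered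
  times in a finite-dimensional distribution are covered at once. For \<open>u\<close> in \<open>I\<close> the
  time before \<open>u\<close> is well defined as soon as \<open>0 < u\<close> and \<open>0 \<in> I\<close>.\<close>

definition time_pred :: "real set \<Rightarrow> real \<Rightarrow> real" where
  "time_pred I u = Max {v \<in> I. v < u}"

text \<open>Negative values of \<open>p\<close> are cut off, because the Markov property integrates
  \<open>ennreal (p \<dots>)\<close>, which is \<open>0\<close> there.\<close>

definition path_density ::
  "(real \<Rightarrow> real \<Rightarrow> real \<Rightarrow> real \<Rightarrow> real) \<Rightarrow> real set \<Rightarrow> (real \<Rightarrow> real) \<Rightarrow> real" where
  "path_density p I y =
     (\<Prod>u\<in>I - {0}. max 0 (p (time_pred I u) u (y (time_pred I u)) (y u)))"

text \<open>The starting value \<open>0\<close> at time \<open>0\<close> is encoded in the reference measure, a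
  point mass, and not in the density. The joint law of all times, including \<open>0\<close>, then has a
  density with respect to one product measure, and the first step of the process is a step like any
  other.\<close>

definition start_ref :: "real \<Rightarrow> real measure" where
  "start_ref u = (if u = 0 then return borel 0 else lborel)"

lemma sets_start_ref [simp, measurable_cong]: "sets (start_ref u) = sets borel"
  by (simp add: start_ref_def)

lemma sigma_finite_start_ref: "sigma_finite_measure (start_ref u)"
proof (cases "u = 0")
  case True
  then show ?thesis
    by (simp add: start_ref_def prob_space_imp_sigma_finite prob_space_return)
next
  case False
  then show ?thesis
    by (simp add: start_ref_def lborel.sigma_finite_measure_axioms)
qed

interpretation start_ref: product_sigma_finite start_ref
  by (rule product_sigma_finite.intro) (rule sigma_finite_start_ref)

lemma sets_PiM_start_ref [measurable_cong]: "sets (PiM I start_ref) = sets (PiM I (\<lambda>_. borel))"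
  by (rule sets_PiM_cong) auto

lemma time_pred_in:
  assumes "finite I" "0 \<in> I" "0 < u"
  shows "time_pred I u \<in> I" "0 \<le> time_pred I u" "time_pred I u < u"
proof -
  have f: "finite {v \<in> I. v < u}" "{v \<in> I. v < u} \<noteq> {}"
    using assms by auto
  from Max_in[OF f] show "time_pred I u \<in> I" "time_pred I u < u"
    by (auto simp: time_pred_def)
  show "0 \<le> time_pred I u"
    unfolding time_pred_def using f assms by (intro Max_ge) auto
qed

lemma path_density_nonneg [simp]: "0 \<le> path_density p I y"
  by (auto simp: path_density_def intro!: prod_nonneg)

text \<open>Adding a time later than all others multiplies the density by one transition and leaves
  the predecessors of the earlier times alone.\<close>

lemma path_density_insert:
  assumes "finite J" "\<And>u. u \<in> J \<Longrightarrow> 0 < u \<and> u < b" "0 < b"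
  shows "path_density p (insert b (insert 0 J)) (y(b := z)) =
     path_density p (insert 0 J) y * max 0 (p (Max (insert 0 J)) b (y (Max (insert 0 J))) z)"
proof -
  let ?I = "insert 0 J"
  have b: "b \<notin> ?I" using assms by force
  have tb: "time_pred (insert b ?I) b = Max ?I"
  proof -
    have "{v \<in> insert b ?I. v < b} = ?I" using assms by auto
    then show ?thesis by (simp add: time_pred_def)
  qed
  have tu: "time_pred (insert b ?I) u = time_pred ?I u" if "u \<in> J" for u
  proof -
    have "{v \<in> insert b ?I. v < u} = {v \<in> ?I. v < u}" using assms(2)[OF that] by auto
    then show ?thesis by (simp add: time_pred_def)
  qed
  have mI: "Max ?I \<in> ?I" using assms by (intro Max_in) auto
  have pr: "time_pred ?I u \<noteq> b" if "u \<in> J" for u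
    using time_pred_in[of ?I u] assms(1) assms(2)[OF that] by auto
  have "insert b ?I - {0} = insert b J" "?I - {0} = J"
    using assms by auto
  moreover have "b \<notin> J" using b by simp
  moreover have "Max ?I \<noteq> b" using mI b by metis
  ultimately show ?thesis
    unfolding path_density_def using assms(1) pr
    by (simp add: tb tu mult.commute) (intro disjI2 prod.cong, auto simp: tu)
qed

lemma measurable_path_density:
  assumes p: "borel_transition 0 p"
    and "finite I" "0 \<in> I" "I \<subseteq> {0..}"
  shows "path_density p I \<in> borel_measurable (PiM I start_ref)"
proof -
  have "(\<lambda>y. p (time_pred I u) u (y (time_pred I u)) (y u)) \<in> borel_measurable (PiM I start_ref)"
    if "u \<in> I - {0}" for u
  proof -
    have u: "0 < u" "u \<in> I" using that assms by (auto simp: less_le)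
    note tp = time_pred_in[OF assms(2,3) u(1)]
    have [measurable]: "(\<lambda>y. y (time_pred I u)) \<in> borel_measurable (PiM I start_ref)"
         "(\<lambda>y. y u) \<in> borel_measurable (PiM I start_ref)"
      using measurable_component_singleton[of _ I start_ref] tp u
        measurable_cong_sets[OF refl sets_start_ref] by blast+
    have "(\<lambda>y. case_prod (p (time_pred I u) u) (y (time_pred I u), y u))
             \<in> borel_measurable (PiM I start_ref)"
      by (rule measurable_compose[OF _ borel_transitionD[OF p tp(2,3)]]) measurable
    then show ?thesis by simp
  qed
  then show ?thesis
    unfolding path_density_def[abs_def]
    by (intro borel_measurable_prod borel_measurable_max) auto
qed

lemma sets_PiM_borel_box:
  assumes "\<And>u. u \<in> I \<Longrightarrow> A u \<in> sets borel" "finite I"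
  shows "Pi\<^sub>E I A \<in> sets (PiM I (\<lambda>_. borel))"
  using assms by (intro sets_PiM_I_finite) auto

text \<open>Induction over the times in increasing order. Both sides are finite measures on a product
  space, so they are compared on boxes. There the one-step formula splits off the last time, the
  induction hypothesis turns the expectation over the earlier times into an integral, and Fubini
  puts the last coordinate back.\<close>

proposition markov_process_joint_distr:
  fixes X :: "real \<Rightarrow> 'a \<Rightarrow> real"
  assumes X: "markov_process_from p 0 0 M X"
    and p: "borel_transition 0 p"
    and J: "finite J" "\<And>u. u \<in> J \<Longrightarrow> 0 < u"
  shows "distr M (PiM (insert 0 J) (\<lambda>_. borel)) (\<lambda>\<omega>. \<lambda>u\<in>insert 0 J. X u \<omega>) =
     density (PiM (insert 0 J) start_ref) (\<lambda>y. ennreal (path_density p (insert 0 J) y))"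
  using J
proof (induction rule: finite_linorder_max_induct)
  case empty
  interpret prob_space M using X by (simp add: markov_process_from_def)
  have [measurable]: "X 0 \<in> borel_measurable M" using X by (simp add: markov_process_from_def)
  have 0: "AE \<omega> in M. X 0 \<omega> = 0" using X by (simp add: markov_process_from_def)
  have m: "(\<lambda>\<omega>. \<lambda>u\<in>{0}. X u \<omega>) \<in> measurable M (PiM {0} (\<lambda>_. borel))"
    by (rule measurable_restrict) auto
  have "distr M (PiM {0} (\<lambda>_. borel)) (\<lambda>\<omega>. \<lambda>u\<in>{0}. X u \<omega>) = PiM {0} start_ref"
  proof (rule start_ref.PiM_eqI)
    fix A :: "real \<Rightarrow> real set" assume A: "\<And>i. i \<in> {0} \<Longrightarrow> A i \<in> sets (start_ref i)"
    then have A0: "A 0 \<in> sets borel" by simp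
    have "emeasure (distr M (PiM {0} (\<lambda>_. borel)) (\<lambda>\<omega>. \<lambda>u\<in>{0}. X u \<omega>)) (Pi\<^sub>E {0} A)
       = emeasure M {\<omega> \<in> space M. X 0 \<omega> \<in> A 0}"
      using A m by (subst emeasure_distr) (auto intro!: sets_PiM_borel_box arg_cong[where f="emeasure M"])
    also have "\<dots> = emeasure M {\<omega> \<in> space M. 0 \<in> A 0}"
      using 0 A0 by (intro emeasure_eq_AE) auto
    also have "\<dots> = indicator (A 0) 0"
      by (auto simp: indicator_def emeasure_space_1)
    finally show "emeasure (distr M (PiM {0} (\<lambda>_. borel)) (\<lambda>\<omega>. \<lambda>u\<in>{0}. X u \<omega>)) (Pi\<^sub>E {0} A)
       = (\<Prod>i\<in>{0}. emeasure (start_ref i) (A i))"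
      using A0 by (simp add: start_ref_def)
  qed (auto simp: sets_PiM_start_ref)
  moreover have "path_density p {0} = (\<lambda>_. 1)"
    by (auto simp: path_density_def)
  ultimately show ?case
    by (simp add: density_1 del: restrict_apply)
next
  case (insert b J)
  let ?I = "insert 0 J" and ?m = "Max (insert 0 J)"
  have pos: "0 < u" "u < b" if "u \<in> J" for u using insert that by auto
  have b: "0 < b" "b \<notin> ?I" using insert by force+
  have fin: "finite ?I" using insert by auto
  have mI: "?m \<in> ?I" using fin by (intro Max_in) auto
  have m: "0 \<le> ?m" "?m < b" "\<And>u. u \<in> ?I \<Longrightarrow> u \<le> ?m"
    using fin mI b pos by (auto simp del: Max_insert) 
  have nn: "0 \<le> u" if "u \<in> ?I" for u using that pos by force
  have IH: "distr M (PiM ?I (\<lambda>_. borel)) (\<lambda>\<omega>. \<lambda>u\<in>?I. X u \<omega>) =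
     density (PiM ?I start_ref) (\<lambda>y. ennreal (path_density p ?I y))"
    using insert.IH pos by blast
  interpret prob_space M using X by (simp add: markov_process_from_def)
  have Xm [measurable]: "X u \<in> borel_measurable M" if "0 \<le> u" for u
    using X that by (simp add: markov_process_from_def)
  have mXI: "(\<lambda>\<omega>. \<lambda>u\<in>?I. X u \<omega>) \<in> measurable M (PiM ?I (\<lambda>_. borel))"
    using nn by (intro measurable_restrict Xm) auto
  have mXb: "(\<lambda>\<omega>. \<lambda>u\<in>insert b ?I. X u \<omega>) \<in> measurable M (PiM (insert b ?I) (\<lambda>_. borel))"
    using nn b by (intro measurable_restrict Xm) auto
  have pm [measurable]: "case_prod (p ?m b) \<in> borel_measurable (borel \<Otimes>\<^sub>M borel)"
    using borel_transitionD[OF p m(1,2)] .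
  have hI [measurable]: "path_density p ?I \<in> borel_measurable (PiM ?I start_ref)"
    using fin nn by (intro measurable_path_density p) auto
  have hb [measurable]: "path_density p (insert b ?I) \<in> borel_measurable (PiM (insert b ?I) start_ref)"
    using fin nn b by (intro measurable_path_density p) (auto simp: less_imp_le)
  have "distr M (PiM (insert b ?I) (\<lambda>_. borel)) (\<lambda>\<omega>. \<lambda>u\<in>insert b ?I. X u \<omega>) =
     density (PiM (insert b ?I) start_ref) (\<lambda>y. ennreal (path_density p (insert b ?I) y))"
  proof (rule measure_eqI_PiM_finite[where A = "\<lambda>_. Pi\<^sub>E (insert b ?I) (\<lambda>_. UNIV)" and M = "\<lambda>_. borel"])
    fix A :: "real \<Rightarrow> real set"
    assume "\<And>i. i \<in> insert b ?I \<Longrightarrow> A i \<in> sets borel"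
    then have A: "A i \<in> sets borel" if "i \<in> insert b ?I" for i using that by blast
    then have [measurable]: "A b \<in> sets borel" by blast
    \<comment> \<open>The probability of a last step into \<open>A b\<close>, as a function of the position at the
        last but one time \<open>?m\<close>.\<close>
    define K where "K z = (\<integral>\<^sup>+y\<in>A b. ennreal (p ?m b z y) \<partial>lborel)" for z
    have Km [measurable]: "K \<in> borel_measurable borel"
    proof -
      have "(\<lambda>(z, y). ennreal (p ?m b z y) * indicator (A b) y) \<in> borel_measurable (borel \<Otimes>\<^sub>M lborel)"
        by measurable
      from lborel.borel_measurable_nn_integral[OF this] show ?thesis
        unfolding K_def[abs_def] .
    qed
    have ym: "(\<lambda>y. y ?m) \<in> borel_measurable (PiM ?I start_ref)" 
      using measurable_component_singleton[of ?m ?I start_ref] mI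
        measurable_cong_sets[OF refl sets_start_ref] by blast
    then have Kym [measurable]: "(\<lambda>y. K (y ?m)) \<in> borel_measurable (PiM ?I start_ref)"
      by measurable
    have boxI: "Pi\<^sub>E ?I A \<in> sets (PiM ?I (\<lambda>_. borel))"
      using A fin by (intro sets_PiM_borel_box) auto
    then have boxI' [measurable]: "Pi\<^sub>E ?I A \<in> sets (PiM ?I start_ref)"
      by (simp only: sets_PiM_start_ref)
    have boxb: "Pi\<^sub>E (insert b ?I) A \<in> sets (PiM (insert b ?I) (\<lambda>_. borel))"
      using A fin by (intro sets_PiM_borel_box) auto
    then have boxb' [measurable]: "Pi\<^sub>E (insert b ?I) A \<in> sets (PiM (insert b ?I) start_ref)"
      by (simp only: sets_PiM_start_ref)
    define B where "B = (\<Inter>u\<in>?I. X u -` A u \<inter> space M)"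
    have B: "B \<in> sets (natural_filtration M X 0 ?m)"
      unfolding B_def
    proof (intro sets.finite_INT fin)
      fix u assume u: "u \<in> ?I"
      have "X u \<in> borel_measurable (natural_filtration M X 0 ?m)"
        using m nn u by (intro measurable_natural_filtration) auto
      from measurable_sets[OF this, of "A u"] show "X u -` A u \<inter> space M \<in> sets (natural_filtration M X 0 ?m)"
        using A u by auto
    qed auto
    have "emeasure (distr M (PiM (insert b ?I) (\<lambda>_. borel)) (\<lambda>\<omega>. \<lambda>u\<in>insert b ?I. X u \<omega>)) (Pi\<^sub>E (insert b ?I) A)
       = emeasure M (B \<inter> (X b -` A b \<inter> space M))"
      unfolding emeasure_distr[OF mXb boxb]
      by (rule arg_cong[where f = "emeasure M"]) (auto simp: B_def PiE_iff)
    also have "\<dots> = (\<integral>\<^sup>+\<omega>. indicator B \<omega> * K (X ?m \<omega>) \<partial>M)"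
      unfolding K_def by (rule markov_process_one_step[OF X m(1,2) B]) (use A in auto)
    also have "\<dots> = (\<integral>\<^sup>+\<omega>. (\<lambda>y. indicator (Pi\<^sub>E ?I A) y * K (y ?m)) (\<lambda>u\<in>?I. X u \<omega>) \<partial>M)"
      using mI by (intro nn_integral_cong) (auto simp: B_def indicator_def PiE_iff)
    also have "\<dots> = (\<integral>\<^sup>+y. indicator (Pi\<^sub>E ?I A) y * K (y ?m) \<partial>distr M (PiM ?I (\<lambda>_. borel)) (\<lambda>\<omega>. \<lambda>u\<in>?I. X u \<omega>))"
    proof (rule nn_integral_distr[symmetric, OF mXI])
      have "(\<lambda>y. indicator (Pi\<^sub>E ?I A) y * K (y ?m)) \<in> borel_measurable (PiM ?I start_ref)"
        by measurable
      then show "(\<lambda>y. indicator (Pi\<^sub>E ?I A) y * K (y ?m)) \<in> borel_measurable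
          (distr M (PiM ?I (\<lambda>_. borel)) (\<lambda>\<omega>. \<lambda>u\<in>?I. X u \<omega>))"
        by (simp only: measurable_distr_eq1 measurable_cong_sets[OF sets_PiM_start_ref refl])
    qed
    also have "\<dots> = (\<integral>\<^sup>+y. ennreal (path_density p ?I y) * (indicator (Pi\<^sub>E ?I A) y * K (y ?m)) \<partial>PiM ?I start_ref)"
      unfolding IH by (subst nn_integral_density) measurable
    also have "\<dots> = (\<integral>\<^sup>+y. (\<integral>\<^sup>+z. ennreal (path_density p (insert b ?I) (y(b := z))) * indicator (Pi\<^sub>E (insert b ?I) A) (y(b := z)) \<partial>start_ref b) \<partial>PiM ?I start_ref)"
    proof (rule nn_integral_cong)
      fix y assume y: "y \<in> space (PiM ?I start_ref)"
      have "(\<integral>\<^sup>+z. ennreal (path_density p (insert b ?I) (y(b := z))) * indicator (Pi\<^sub>E (insert b ?I) A) (y(b := z)) \<partial>start_ref b)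
        = (\<integral>\<^sup>+z. (ennreal (path_density p ?I y) * indicator (Pi\<^sub>E ?I A) y) * (ennreal (p ?m b (y ?m) z) * indicator (A b) z) \<partial>lborel)"
      proof -
        have "ennreal (path_density p (insert b ?I) (y(b := z))) * indicator (Pi\<^sub>E (insert b ?I) A) (y(b := z))
          = (ennreal (path_density p ?I y) * indicator (Pi\<^sub>E ?I A) y) * (ennreal (p ?m b (y ?m) z) * indicator (A b) z)" for z
        proof -
          have "indicator (Pi\<^sub>E (insert b ?I) A) (y(b := z)) = (indicator (Pi\<^sub>E ?I A) y * indicator (A b) z :: ennreal)"
            using y b by (auto simp: indicator_def PiE_iff space_PiM extensional_def)
          then show ?thesis
            using path_density_insert[OF insert(1), of b p y z] pos b
            by (auto simp: ennreal_mult' ac_simps max_def ennreal_neg)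
        qed
        then show ?thesis using b by (simp add: start_ref_def)
      qed
      also have "\<dots> = (ennreal (path_density p ?I y) * indicator (Pi\<^sub>E ?I A) y) * K (y ?m)"
        unfolding K_def by (rule nn_integral_cmult) measurable
      finally show "ennreal (path_density p ?I y) * (indicator (Pi\<^sub>E ?I A) y * K (y ?m)) = (\<integral>\<^sup>+z. ennreal (path_density p (insert b ?I) (y(b := z))) * indicator (Pi\<^sub>E (insert b ?I) A) (y(b := z)) \<partial>start_ref b)"
        by (simp add: mult.assoc)
    qed
    also have "\<dots> = (\<integral>\<^sup>+y. ennreal (path_density p (insert b ?I) y) * indicator (Pi\<^sub>E (insert b ?I) A) y \<partial>PiM (insert b ?I) start_ref)"
      by (rule start_ref.product_nn_integral_insert[symmetric, OF fin b(2)]) measurable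
    also have "\<dots> = emeasure (density (PiM (insert b ?I) start_ref) (\<lambda>y. ennreal (path_density p (insert b ?I) y))) (Pi\<^sub>E (insert b ?I) A)"
      by (rule emeasure_density[symmetric]) measurable
    finally show "emeasure (distr M (PiM (insert b ?I) (\<lambda>_. borel)) (\<lambda>\<omega>. \<lambda>u\<in>insert b ?I. X u \<omega>)) (Pi\<^sub>E (insert b ?I) A) = \<dots>" .
  next
    show "range (\<lambda>_. Pi\<^sub>E (insert b ?I) (\<lambda>_. UNIV)) \<subseteq> prod_algebra (insert b ?I) (\<lambda>_. borel)"
      using fin by (auto intro!: prod_algebraI_finite)
  next
    interpret D: prob_space "distr M (PiM (insert b ?I) (\<lambda>_. borel)) (\<lambda>\<omega>. \<lambda>u\<in>insert b ?I. X u \<omega>)"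
      by (rule prob_space_distr[OF mXb])
    show "emeasure (distr M (PiM (insert b ?I) (\<lambda>_. borel)) (\<lambda>\<omega>. \<lambda>u\<in>insert b ?I. X u \<omega>)) (Pi\<^sub>E (insert b ?I) (\<lambda>_. UNIV)) \<noteq> \<infinity>"
      by (simp add: D.emeasure_finite)
  qed (use fin in \<open>auto simp: sets_PiM_start_ref space_PiM\<close>)
  then show ?case by (simp add: insert_commute del: restrict_apply)
qed

section \<open>Convergence of finite-dimensional distributions from convergence of densities\<close>

text \<open>Scheffe's argument from one side. For densities of equal mass,
  \<open>\<integral> \<bar>H n - h\<bar> = 2 - 2 \<integral> min (H n) h\<close>, and the integral on the right converges by
  dominated convergence with the majorant \<open>h\<close>. So it is enough that asymptotically
  \<open>H n\<close> does not fall below \<open>h\<close>: where \<open>h\<close> vanishes, nothing has to be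
  known about \<open>H n\<close>. For the densities below this means that the limit has to be computed
  only where the limiting density is positive.\<close>

lemma integral_tendsto_of_densities_from_below:
  fixes h :: "'a \<Rightarrow> real" and H :: "nat \<Rightarrow> 'a \<Rightarrow> real" and g :: "'a \<Rightarrow> real"
  assumes [measurable]: "h \<in> borel_measurable R" "\<And>n. H n \<in> borel_measurable R" "g \<in> borel_measurable R"
    and nonneg: "\<And>x. 0 \<le> h x" "\<And>n x. 0 \<le> H n x"
    and mass: "(\<integral>\<^sup>+x. ennreal (h x) \<partial>R) = 1" "\<And>n. (\<integral>\<^sup>+x. ennreal (H n x) \<partial>R) = 1"
    and lim: "\<And>x. (\<lambda>n. min (H n x) (h x)) \<longlonglongrightarrow> h x"
    and g: "\<And>x. \<bar>g x\<bar> \<le> C"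
  shows "(\<lambda>n. \<integral>x. H n x * g x \<partial>R) \<longlonglongrightarrow> (\<integral>x. h x * g x \<partial>R)"
proof -
  have ih: "integrable R h" "integral\<^sup>L R h = 1"
    using mass(1) nonneg by (auto intro!: integrableI_nonneg integral_eq_nn_integral[THEN trans])
  have iH: "integrable R (H n)" "integral\<^sup>L R (H n) = 1" for n
    using mass(2)[of n] nonneg by (auto intro!: integrableI_nonneg integral_eq_nn_integral[THEN trans])
  have C: "0 \<le> C" using g[of undefined] by linarith
  have imin: "integrable R (\<lambda>x. min (H n x) (h x))" for n
    by (rule integrable_min) (use ih iH in auto)
  have m: "(\<lambda>n. \<integral>x. min (H n x) (h x) \<partial>R) \<longlonglongrightarrow> integral\<^sup>L R h"
    by (rule integral_dominated_convergence[where w = h])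
      (use ih lim nonneg in \<open>auto simp: min_def\<close>)
  have "(\<lambda>n. C * (2 - 2 * (\<integral>x. min (H n x) (h x) \<partial>R))) \<longlonglongrightarrow> C * (2 - 2 * integral\<^sup>L R h)"
    by (intro tendsto_intros m)
  then have lim0: "(\<lambda>n. C * (2 - 2 * (\<integral>x. min (H n x) (h x) \<partial>R))) \<longlonglongrightarrow> 0"
    by (simp add: ih)
  have ig: "integrable R (\<lambda>x. H n x * g x)" for n
    by (rule Bochner_Integration.integrable_bound[OF integrable_mult_right[OF iH(1)[of n], of C]])
      (use g nonneg C in \<open>auto simp: abs_mult intro!: mult_left_mono simp: mult.commute[of C]\<close>)
  have ig': "integrable R (\<lambda>x. h x * g x)"
    by (rule Bochner_Integration.integrable_bound[OF integrable_mult_right[OF ih(1), of C]])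
      (use g nonneg C in \<open>auto simp: abs_mult intro!: mult_left_mono simp: mult.commute[of C]\<close>)
  have "norm ((\<integral>x. H n x * g x \<partial>R) - (\<integral>x. h x * g x \<partial>R)) \<le> C * (2 - 2 * (\<integral>x. min (H n x) (h x) \<partial>R))" for n
  proof -
    have "norm ((\<integral>x. H n x * g x \<partial>R) - (\<integral>x. h x * g x \<partial>R)) = norm (\<integral>x. H n x * g x - h x * g x \<partial>R)"
      using ig ig' by simp
    also have "\<dots> \<le> (\<integral>x. norm (H n x * g x - h x * g x) \<partial>R)"
      by (rule integral_norm_bound)
    also have "\<dots> \<le> (\<integral>x. C * (H n x + h x - 2 * min (H n x) (h x)) \<partial>R)"
    proof (rule integral_mono)
      fix x
      have "norm (H n x * g x - h x * g x) = \<bar>H n x - h x\<bar> * \<bar>g x\<bar>"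
        by (simp add: left_diff_distrib[symmetric] abs_mult)
      also have "\<dots> \<le> \<bar>H n x - h x\<bar> * C"
        by (rule mult_left_mono) (use g in auto)
      also have "\<bar>H n x - h x\<bar> = H n x + h x - 2 * min (H n x) (h x)"
        by (simp add: min_def)
      finally show "norm (H n x * g x - h x * g x) \<le> C * (H n x + h x - 2 * min (H n x) (h x))"
        by (simp add: mult.commute)
    qed (use ig ig' ih iH imin in auto)
    also have "\<dots> = C * (2 - 2 * (\<integral>x. min (H n x) (h x) \<partial>R))"
      using ih iH imin by simp
    finally show ?thesis .
  qed
  then have "(\<lambda>n. (\<integral>x. H n x * g x \<partial>R) - (\<integral>x. h x * g x \<partial>R)) \<longlonglongrightarrow> 0"
    by (intro Lim_null_comparison[OF _ lim0]) auto
  then show ?thesis by (simp add: LIM_zero_iff)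
qed

text \<open>If one factor of the limit vanishes, so does the minimum in the limit, whatever the other
  factors do.\<close>

lemma min_prod_tendsto:
  fixes f :: "'i \<Rightarrow> real" and F :: "nat \<Rightarrow> 'i \<Rightarrow> real"
  assumes "finite I" "\<And>i. i \<in> I \<Longrightarrow> 0 \<le> f i" "\<And>i n. i \<in> I \<Longrightarrow> 0 \<le> F n i"
    and "\<And>i. i \<in> I \<Longrightarrow> f i \<noteq> 0 \<Longrightarrow> (\<lambda>n. F n i) \<longlonglongrightarrow> f i"
  shows "(\<lambda>n. min (\<Prod>i\<in>I. F n i) (\<Prod>i\<in>I. f i)) \<longlonglongrightarrow> (\<Prod>i\<in>I. f i)"
proof (cases "\<exists>i\<in>I. f i = 0")
  case True
  then have "(\<Prod>i\<in>I. f i) = 0" using assms(1) by simp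
  moreover have "0 \<le> (\<Prod>i\<in>I. F n i)" for n using assms(3) by (intro prod_nonneg) auto
  ultimately show ?thesis by (simp add: min_absorb2)
next
  case False
  then have "(\<lambda>n. \<Prod>i\<in>I. F n i) \<longlonglongrightarrow> (\<Prod>i\<in>I. f i)"
    by (intro tendsto_prod assms) auto
  from tendsto_min[OF this tendsto_const[of "\<Prod>i\<in>I. f i"]] show ?thesis by simp
qed

lemma borel_measurable_vec_lambda:
  fixes f :: "'n::finite \<Rightarrow> 'a \<Rightarrow> real"
  assumes "\<And>i. f i \<in> borel_measurable M"
  shows "(\<lambda>\<omega>. \<chi> i. f i \<omega>) \<in> borel_measurable M"
proof (rule borel_measurable_euclidean_space[THEN iffD2], rule ballI)
  fix b :: "real ^ 'n" assume "b \<in> Basis"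
  then show "(\<lambda>\<omega>. (\<chi> i. f i \<omega>) \<bullet> b) \<in> borel_measurable M"
    using assms by (auto simp: Basis_vec_def inner_axis)
qed

text \<open>The total mass \<open>1\<close> of \<open>path_density\<close> is obtained from the existence of the
  process, and not by integrating explicit transition densities. Scheffe's argument needs it for
  the limit and for the approximations.\<close>

lemma markov_process_fin_dim_integral:
  fixes X :: "real \<Rightarrow> 'a \<Rightarrow> real" and t :: "real ^ 'n" and f :: "real ^ 'n \<Rightarrow> real"
  assumes X: "markov_process_from p 0 0 M X"
    and p: "borel_transition 0 p"
    and t: "\<And>i. 0 \<le> t $ i" and f [measurable]: "f \<in> borel_measurable borel"
  defines "I \<equiv> insert 0 (range (($) t))"
  shows "(\<integral>\<omega>. f (\<chi> i. X (t $ i) \<omega>) \<partial>M) =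
      (\<integral>y. path_density p I y * f (\<chi> i. y (t $ i)) \<partial>PiM I start_ref)"
    and "(\<integral>\<^sup>+y. ennreal (path_density p I y) \<partial>PiM I start_ref) = 1"
    and "path_density p I \<in> borel_measurable (PiM I start_ref)"
    and "(\<lambda>y. f (\<chi> i. y (t $ i))) \<in> borel_measurable (PiM I start_ref)"
proof -
  interpret prob_space M using X by (simp add: markov_process_from_def)
  define J where "J = I - {0}"
  have I: "I = insert 0 J" "finite J" and J0: "\<And>u. u \<in> J \<Longrightarrow> 0 < u"
    using t by (auto simp: I_def J_def less_le)
  have It: "t $ i \<in> I" for i by (simp add: I_def)
  have joint: "distr M (PiM I (\<lambda>_. borel)) (\<lambda>\<omega>. \<lambda>u\<in>I. X u \<omega>) =
     density (PiM I start_ref) (\<lambda>y. ennreal (path_density p I y))"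
    unfolding I(1) by (rule markov_process_joint_distr[OF X p]) (use I J0 in auto)
  have XI: "(\<lambda>\<omega>. \<lambda>u\<in>I. X u \<omega>) \<in> measurable M (PiM I (\<lambda>_. borel))"
    using X t by (intro measurable_restrict) (auto simp: markov_process_from_def I_def)
  show h: "path_density p I \<in> borel_measurable (PiM I start_ref)"
    by (rule measurable_path_density[OF p]) (use I J0 in \<open>auto simp: less_imp_le\<close>)
  have fm: "(\<lambda>y. f (\<chi> i. y (t $ i))) \<in> borel_measurable (PiM I (\<lambda>_. borel))"
    by (rule measurable_compose[OF borel_measurable_vec_lambda f])
      (use It in \<open>auto intro: measurable_component_singleton\<close>)
  then show fm': "(\<lambda>y. f (\<chi> i. y (t $ i))) \<in> borel_measurable (PiM I start_ref)"
    by (simp only: measurable_cong_sets[OF sets_PiM_start_ref refl])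
  have "(\<integral>\<omega>. f (\<chi> i. X (t $ i) \<omega>) \<partial>M)
     = (\<integral>\<omega>. (\<lambda>y. f (\<chi> i. y (t $ i))) (\<lambda>u\<in>I. X u \<omega>) \<partial>M)"
    using It by simp
  also have "\<dots> = (\<integral>y. f (\<chi> i. y (t $ i)) \<partial>distr M (PiM I (\<lambda>_. borel)) (\<lambda>\<omega>. \<lambda>u\<in>I. X u \<omega>))"
    by (rule integral_distr[symmetric, OF XI fm])
  also have "\<dots> = (\<integral>y. path_density p I y * f (\<chi> i. y (t $ i)) \<partial>PiM I start_ref)"
    unfolding joint using h fm' by (subst integral_density) auto
  finally show "(\<integral>\<omega>. f (\<chi> i. X (t $ i) \<omega>) \<partial>M) =
      (\<integral>y. path_density p I y * f (\<chi> i. y (t $ i)) \<partial>PiM I start_ref)" .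
  interpret D: prob_space "density (PiM I start_ref) (\<lambda>y. ennreal (path_density p I y))"
    unfolding joint[symmetric] by (rule prob_space_distr[OF XI])
  show "(\<integral>\<^sup>+y. ennreal (path_density p I y) \<partial>PiM I start_ref) = 1"
    using D.emeasure_space_1 h by (simp add: emeasure_density cong: nn_integral_cong)
qed


text \<open>Pointwise convergence of transition densities gives convergence of the joint densities in
  \<open>L\<^sup>1\<close>, hence convergence of the expectations of all bounded Borel functions.\<close>

proposition fin_dim_convergence_of_transition_densities:
  fixes X :: "nat \<Rightarrow> real \<Rightarrow> 'a \<Rightarrow> real" and Z :: "real \<Rightarrow> 'b \<Rightarrow> real"
    and t :: "real ^ 'n" and f :: "real ^ 'n \<Rightarrow> real"
  assumes X: "\<And>n. markov_process_from (P n) 0 0 M (X n)"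
    and Z: "markov_process_from p 0 0 N Z"
    and P: "\<And>n. borel_transition 0 (P n)"
    and p: "borel_transition 0 p"
    and lim: "\<And>t1 t2 y1 y2. 0 \<le> t1 \<Longrightarrow> t1 < t2 \<Longrightarrow> 0 < p t1 t2 y1 y2 \<Longrightarrow>
       (\<lambda>n. P n t1 t2 y1 y2) \<longlonglongrightarrow> p t1 t2 y1 y2"
    and t: "\<And>i. 0 \<le> t $ i" and f: "f \<in> borel_measurable borel" "\<And>v. \<bar>f v\<bar> \<le> C"
  shows "(\<lambda>n. \<integral>\<omega>. f (\<chi> i. X n (t $ i) \<omega>) \<partial>M) \<longlonglongrightarrow> (\<integral>\<omega>. f (\<chi> i. Z (t $ i) \<omega>) \<partial>N)"
proof -
  define I where "I = insert 0 (range (($) t))"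
  have fin: "finite I" by (simp add: I_def)
  note XI = markov_process_fin_dim_integral[OF X P t f(1), folded I_def]
  note ZI = markov_process_fin_dim_integral[OF Z p t f(1), folded I_def]
  have min_lim: "(\<lambda>n. min (path_density (P n) I y) (path_density p I y)) \<longlonglongrightarrow> path_density p I y" for y
    unfolding path_density_def
  proof (rule min_prod_tendsto)
    fix u assume u: "u \<in> I - {0}"
      and nz: "max 0 (p (time_pred I u) u (y (time_pred I u)) (y u)) \<noteq> 0"
    have "0 < u" using u t by (auto simp: I_def less_le)
    then have "0 \<le> time_pred I u" "time_pred I u < u"
      using time_pred_in[of I u] fin by (auto simp: I_def)
    with nz have "(\<lambda>n. P n (time_pred I u) u (y (time_pred I u)) (y u))
        \<longlonglongrightarrow> p (time_pred I u) u (y (time_pred I u)) (y u)"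
      by (intro lim) (auto simp: max_def split: if_splits)
    then show "(\<lambda>n. max 0 (P n (time_pred I u) u (y (time_pred I u)) (y u)))
        \<longlonglongrightarrow> max 0 (p (time_pred I u) u (y (time_pred I u)) (y u))"
      by (intro tendsto_max tendsto_const)
  qed (use fin in auto)
  show ?thesis
    unfolding XI(1) ZI(1)
    by (rule integral_tendsto_of_densities_from_below[OF ZI(3) XI(3) ZI(4) _ _ ZI(2) XI(2) min_lim f(2)])
      (rule path_density_nonneg)+
qed

section \<open>Affine changes of time and space\<close>

text \<open>Time is rescaled linearly; space is rescaled by a constant after a shift that may depend on
  time. Such a change neither alters the natural filtration nor the conditioning, so only the
  density is substituted.\<close>

proposition markov_process_affine:
  assumes X: "markov_process_from p s x M X"
    and p: "borel_transition s p"
    and e: "0 < e" and d: "0 < d" and b: "b 0 = x"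
  shows "markov_process_from
     (\<lambda>u1 u2 z1 z2. d * p (s + u1 * e) (s + u2 * e) (b u1 + d * z1) (b u2 + d * z2)) 0 0 M
     (\<lambda>u \<omega>. (X (s + u * e) \<omega> - b u) / d)"
proof -
  define Y where "Y u \<omega> = (X (s + u * e) \<omega> - b u) / d" for u \<omega>
  have Xm [measurable]: "X u \<in> borel_measurable M" if "s \<le> u" for u
    using X that by (simp add: markov_process_from_def)
  have YX: "Y u -` A = X (s + u * e) -` ((\<lambda>y. (y - b u) / d) -` A)" for u A
    by (auto simp: Y_def)
  have XY: "X v -` A = Y ((v - s) / e) -` ((\<lambda>z. b ((v - s) / e) + d * z) -` A)" for v A
    using e d by (auto simp: Y_def field_simps)
  \<comment> \<open>The map of space is a bijection at every time, so the generators of the two filtrations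
      are the same events.\<close>
  have filt: "natural_filtration M Y 0 u = natural_filtration M X s (s + u * e)" for u
  proof -
    have "{Y v -` A \<inter> space M | v A. 0 \<le> v \<and> v \<le> u \<and> A \<in> sets borel}
       = {X v -` A \<inter> space M | v A. s \<le> v \<and> v \<le> s + u * e \<and> A \<in> sets borel}" (is "?L = ?R")
    proof (intro equalityI subsetI)
      fix S assume "S \<in> ?L"
      then obtain v A where S: "S = Y v -` A \<inter> space M" "0 \<le> v" "v \<le> u" "A \<in> sets borel" by blast
      have "(\<lambda>y. (y - b v) / d) -` A \<in> sets borel"
        using measurable_sets_borel[of "\<lambda>y. (y - b v) / d" borel A] S by simp
      then show "S \<in> ?R"
        using S e unfolding YX by (intro CollectI exI[of _ "s + v * e"] exI conjI) auto
    next
      fix S assume "S \<in> ?R"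
      then obtain v A where S: "S = X v -` A \<inter> space M" "s \<le> v" "v \<le> s + u * e" "A \<in> sets borel" by blast
      have "(\<lambda>z. b ((v - s) / e) + d * z) -` A \<in> sets borel"
        using measurable_sets_borel[of "\<lambda>z. b ((v - s) / e) + d * z" borel A] S by simp
      then show "S \<in> ?L"
        using S e unfolding XY by (intro CollectI exI[of _ "(v - s) / e"] exI conjI) (auto simp: field_simps)
    qed
    then show ?thesis by (simp add: natural_filtration_def)
  qed
  have integ: "(\<integral>\<^sup>+y\<in>(\<lambda>y. (y - b u2) / d) -` A. ennreal (p t1 t2 x1 y) \<partial>lborel)
      = (\<integral>\<^sup>+z\<in>A. ennreal (d * p t1 t2 x1 (b u2 + d * z)) \<partial>lborel)"
    if A [measurable]: "A \<in> sets borel" and t: "s \<le> t1" "t1 < t2" for A t1 t2 x1 u2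
  proof -
    have [measurable]: "case_prod (p t1 t2) \<in> borel_measurable (borel \<Otimes>\<^sub>M borel)"
      using borel_transitionD[OF p t] .
    have [measurable]: "p t1 t2 x1 \<in> borel_measurable borel"
      using measurable_compose[of "\<lambda>y. (x1, y)" borel "borel \<Otimes>\<^sub>M borel" "case_prod (p t1 t2)" borel] by simp
    have [measurable]: "(\<lambda>y. (y - b u2) / d) -` A \<in> sets borel"
      using measurable_sets_borel[of "\<lambda>y. (y - b u2) / d" borel A] A by simp
    have "(\<integral>\<^sup>+y\<in>(\<lambda>y. (y - b u2) / d) -` A. ennreal (p t1 t2 x1 y) \<partial>lborel)
      = ennreal \<bar>d\<bar> * (\<integral>\<^sup>+z. ennreal (p t1 t2 x1 (b u2 + d * z)) *
           indicator ((\<lambda>y. (y - b u2) / d) -` A) (b u2 + d * z) \<partial>lborel)"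
      by (rule nn_integral_real_affine) (measurable, use d in simp)
    also have "\<dots> = ennreal d * (\<integral>\<^sup>+z\<in>A. ennreal (p t1 t2 x1 (b u2 + d * z)) \<partial>lborel)"
      using d by (simp add: indicator_def)
    also have "\<dots> = (\<integral>\<^sup>+z. ennreal d * (ennreal (p t1 t2 x1 (b u2 + d * z)) * indicator A z) \<partial>lborel)"
      by (rule nn_integral_cmult[symmetric]) measurable
    also have "\<dots> = (\<integral>\<^sup>+z\<in>A. ennreal (d * p t1 t2 x1 (b u2 + d * z)) \<partial>lborel)"
      using d by (simp add: ennreal_mult' mult.assoc)
    finally show ?thesis .
  qed
  have "markov_process_from
     (\<lambda>u1 u2 z1 z2. d * p (s + u1 * e) (s + u2 * e) (b u1 + d * z1) (b u2 + d * z2)) 0 0 M Y"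
    unfolding markov_process_from_def
  proof (intro conjI allI ballI impI)
    show "prob_space M" using X by (simp add: markov_process_from_def)
    show "Y u \<in> borel_measurable M" if "0 \<le> u" for u
    proof -
      have [measurable]: "X (s + u * e) \<in> borel_measurable M" using that e by (intro Xm) auto
      show ?thesis unfolding Y_def by measurable
    qed
    have "AE \<omega> in M. X s \<omega> = x" using X by (simp add: markov_process_from_def)
    then show "AE \<omega> in M. Y 0 \<omega> = 0" by eventually_elim (simp add: Y_def b)
  next
    fix u1 u2 :: real and A :: "real set" assume u: "0 \<le> u1 \<and> u1 < u2" and A: "A \<in> sets borel"
    let ?A = "(\<lambda>y. (y - b u2) / d) -` A"
    have A': "?A \<in> sets borel"
      using measurable_sets_borel[of "\<lambda>y. (y - b u2) / d" borel A] A by simp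
    have t: "s \<le> s + u1 * e" "s + u1 * e < s + u2 * e" using u e by auto
    have "AE \<omega> in M. nn_cond_exp M (natural_filtration M X s (s + u1 * e))
          (indicator (X (s + u2 * e) -` ?A \<inter> space M)) \<omega>
        = (\<integral>\<^sup>+ y\<in>?A. ennreal (p (s + u1 * e) (s + u2 * e) (X (s + u1 * e) \<omega>) y) \<partial>lborel)"
      using X t A' unfolding markov_process_from_def by blast
    moreover have "b u1 + d * Y u1 \<omega> = X (s + u1 * e) \<omega>" for \<omega>
      using d by (simp add: Y_def)
    ultimately show "AE \<omega> in M. nn_cond_exp M (natural_filtration M Y 0 u1)
          (indicator (Y u2 -` A \<inter> space M)) \<omega>
        = (\<integral>\<^sup>+ z\<in>A. ennreal (d * p (s + u1 * e) (s + u2 * e) (b u1 + d * Y u1 \<omega>) (b u2 + d * z)) \<partial>lborel)"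
      by (simp add: filt YX integ[OF A t])
  qed
  then show ?thesis by (simp add: Y_def[abs_def])
qed

lemma borel_transition_affine:
  assumes p: "borel_transition s p" and e: "0 < e"
  shows "borel_transition 0
     (\<lambda>u1 u2 z1 z2. d * p (s + u1 * e) (s + u2 * e) (b u1 + d * z1) (b u2 + d * z2))"
  unfolding borel_transition_def
proof (intro allI impI)
  fix u1 u2 :: real assume u: "0 \<le> u1" "u1 < u2"
  have t: "s \<le> s + u1 * e" "s + u1 * e < s + u2 * e" using u e by auto
  have "(\<lambda>z. case_prod (p (s + u1 * e) (s + u2 * e)) (b u1 + d * fst z, b u2 + d * snd z))
      \<in> borel_measurable (borel \<Otimes>\<^sub>M borel)"
    by (rule measurable_compose[OF _ borel_transitionD[OF p t]]) measurable
  then show "(\<lambda>(z1, z2). d * p (s + u1 * e) (s + u2 * e) (b u1 + d * z1) (b u2 + d * z2))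
      \<in> borel_measurable (borel \<Otimes>\<^sub>M borel)"
    unfolding case_prod_beta by (intro borel_measurable_times borel_measurable_const) simp
qed

section \<open>Measurability of the two transition densities\<close>

text \<open>Where it diverges, an infinite product has a value that does not depend on its factors, so
  it is enough to see that the set of convergence is measurable.\<close>

lemma borel_measurable_prodinf:
  fixes f :: "nat \<Rightarrow> 'a \<Rightarrow> real"
  assumes [measurable]: "\<And>k. f k \<in> borel_measurable M"
  shows "(\<lambda>x. \<Prod>k. f k x) \<in> borel_measurable M"
proof -
  have conv: "convergent_prod g \<longleftrightarrow> (\<exists>m. Cauchy (\<lambda>n. \<Prod>i\<le>n. g (i + m)) \<and> lim (\<lambda>n. \<Prod>i\<le>n. g (i + m)) \<noteq> 0)"
    for g :: "nat \<Rightarrow> real"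
    unfolding convergent_prod_def raw_has_prod_def Cauchy_convergent_iff
    by (metis convergent_def limI)
  have eq: "(\<Prod>k. f k x) = (if \<exists>m. Cauchy (\<lambda>n. \<Prod>i\<le>n. f (i + m) x) \<and> lim (\<lambda>n. \<Prod>i\<le>n. f (i + m) x) \<noteq> 0
       then lim (\<lambda>n. \<Prod>i\<le>n. f i x) else (THE p. False))" for x
  proof (cases "convergent_prod (\<lambda>k. f k x)")
    case True
    then have "lim (\<lambda>n. \<Prod>i\<le>n. f i x) = (\<Prod>k. f k x)"
      by (intro limI convergent_prod_LIMSEQ)
    with True[unfolded conv] show ?thesis by (simp only: if_True)
  next
    case False
    then have "(\<lambda>k. f k x) has_prod p \<longleftrightarrow> False" for p
      by (simp add: has_prod_iff)
    then have "(\<Prod>k. f k x) = (THE p. False)"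
      by (simp add: prodinf_def)
    with False[unfolded conv] show ?thesis by (simp only: if_False)
  qed
  show ?thesis
    unfolding eq by measurable
qed

lemma borel_transition_qBM_density: "borel_transition s (qBM_density q)"
proof -
  have [measurable]: "(\<lambda>z. \<Prod>k. psi_star q (Suc k) t1 t2 (snd z) / phi_star q (Suc k) t1 t2 (fst z) (snd z))
      \<in> borel_measurable (borel \<Otimes>\<^sub>M borel)" for t1 t2
    by (rule borel_measurable_prodinf) (unfold psi_star_def phi_star_def, measurable)
  have [measurable]: "(\<lambda>z. phi_star q 0 t1 t2 (fst z) (snd z)) \<in> borel_measurable (borel \<Otimes>\<^sub>M borel)" for t1 t2
    by (unfold phi_star_def) measurable
  have [measurable]: "qBM_support q t2 \<in> sets borel" for t2
    by (simp add: qBM_support_def)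
  show ?thesis
    unfolding borel_transition_def qBM_density_def case_prod_beta by measurable
qed

lemma borel_transition_biane_density: "borel_transition s biane_density"
  unfolding borel_transition_def biane_density_def case_prod_beta by measurable

section \<open>The density of the q-Brownian motion near the end-point of the support\<close>

text \<open>\<open>phi_star\<close> with \<open>q ^ k\<close> replaced by a variable \<open>r\<close>. For \<open>k \<ge> 1\<close>
  all the values \<open>q ^ k\<close> lie in the compact interval \<open>{-\<bar>q\<bar>..\<bar>q\<bar>}\<close>, so bounds that
  are uniform in \<open>k\<close> follow from continuity in \<open>r\<close>.\<close>

definition phi_poly :: "real \<Rightarrow> real \<Rightarrow> real \<times> real \<times> real \<times> real \<Rightarrow> real" where
  "phi_poly q r = (\<lambda>(t1, t2, y1, y2). (t2 - t1 * r\<^sup>2)\<^sup>2 - (1 - q) * r * (t2 + t1 * r\<^sup>2) * y1 * y2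
     + (1 - q) * (t1 * y2\<^sup>2 + t2 * y1\<^sup>2) * r\<^sup>2)"

text \<open>At \<open>r = 0\<close> the numerator \<open>psi_star\<close> and the denominator \<open>phi_star\<close> both
  equal \<open>t2\<^sup>2\<close>, so their difference is divisible by \<open>r\<close>; this is the quotient.
  It is the reason why the factors of the infinite product are \<open>1 + O(q ^ k)\<close>.\<close>

definition psi_minus_phi_over_r :: "real \<Rightarrow> real \<Rightarrow> real \<times> real \<times> real \<times> real \<Rightarrow> real" where
  "psi_minus_phi_over_r q r = (\<lambda>(t1, t2, y1, y2).
     (let S = 2 * t2 - (1 - q) * y2\<^sup>2 + t2 * r; E = t1 + q * t2 - q * t1 * r in
      t2 * S - t2 * E - r * E * S + 2 * t1 * t2 * r - t1\<^sup>2 * r ^ 3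
      + (1 - q) * (t2 + t1 * r\<^sup>2) * y1 * y2 - (1 - q) * (t1 * y2\<^sup>2 + t2 * y1\<^sup>2) * r))"

lemma phi_star_eq_poly: "phi_star q k t1 t2 y1 y2 = phi_poly q (q ^ k) (t1, t2, y1, y2)"
  by (simp add: phi_star_def phi_poly_def power_mult[symmetric] mult.commute[of 2 k])

lemma psi_star_eq_poly:
  "psi_star q k t1 t2 y2 = phi_poly q (q ^ k) (t1, t2, y1, y2)
     + q ^ k * psi_minus_phi_over_r q (q ^ k) (t1, t2, y1, y2)"
  by (simp add: psi_star_def phi_poly_def psi_minus_phi_over_r_def Let_def) algebra

lemma continuous_on_phi_poly: "continuous_on UNIV (\<lambda>zr. phi_poly q (snd zr) (fst zr))"
  unfolding phi_poly_def case_prod_beta by (intro continuous_intros)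

lemma continuous_on_psi_minus_phi_over_r: "continuous_on UNIV (\<lambda>zr. psi_minus_phi_over_r q (snd zr) (fst zr))"
  unfolding psi_minus_phi_over_r_def Let_def case_prod_beta by (intro continuous_intros)

text \<open>At an end-point of the support, with both times equal to \<open>s\<close>, numerator and
  denominator of the product are pure powers, and the product telescopes.\<close>

lemma phi_poly_endpoint:
  assumes "(1 - q) * x\<^sup>2 = 4 * s"
  shows "phi_poly q r (s, s, x, x) = s\<^sup>2 * (1 - r) ^ 4"
proof -
  have "phi_poly q r (s, s, x, x) = (s - s * r\<^sup>2)\<^sup>2 - r * (s + s * r\<^sup>2) * ((1 - q) * x\<^sup>2)
     + 2 * s * r\<^sup>2 * ((1 - q) * x\<^sup>2)"
    by (simp add: phi_poly_def power2_eq_square algebra_simps)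
  then show ?thesis unfolding assms by algebra
qed

lemma psi_star_endpoint:
  assumes "(1 - q) * x\<^sup>2 = 4 * s"
  shows "psi_star q k s s x = s\<^sup>2 * (1 - q ^ k) ^ 3 * (1 - q ^ Suc k)"
  unfolding psi_star_def assms by simp algebra

text \<open>The infinite product is continuous at \<open>(s, s, x, x)\<close>: on a compact neighbourhood
  \<open>A\<close> the polynomials \<open>phi_poly q r\<close> with \<open>\<bar>r\<bar> \<le> \<bar>q\<bar>\<close> stay positive, the
  factors differ from \<open>1\<close> by at most \<open>C * \<bar>q\<bar> ^ k\<close>, and the partial products converge
  uniformly. At the point itself the factors are
  \<open>(1 - q ^ (k + 1)) / (1 - q ^ k)\<close> for \<open>k \<ge> 1\<close>, with product \<open>1 / (1 - q)\<close>.\<close>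

lemma qBM_product_tendsto:
  fixes T1 T2 Y1 Y2 :: "'i \<Rightarrow> real"
  assumes q: "\<bar>q\<bar> < 1" and s: "0 < s" and x: "(1 - q) * x\<^sup>2 = 4 * s"
    and T1: "(T1 \<longlongrightarrow> s) F" and T2: "(T2 \<longlongrightarrow> s) F" and Y1: "(Y1 \<longlongrightarrow> x) F" and Y2: "(Y2 \<longlongrightarrow> x) F"
  shows "((\<lambda>e. \<Prod>k. psi_star q (Suc k) (T1 e) (T2 e) (Y2 e)
             / phi_star q (Suc k) (T1 e) (T2 e) (Y1 e) (Y2 e)) \<longlongrightarrow> 1 / (1 - q)) F"
proof -
  define K where "K = {-\<bar>q\<bar>..\<bar>q\<bar>}"
  define x0 where "x0 = (s, s, x, x)"
  have pow: "q ^ Suc k \<in> K" for k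
  proof -
    have "\<bar>q ^ Suc k\<bar> \<le> \<bar>q\<bar>"
      using q power_decreasing[of 1 "Suc k" "\<bar>q\<bar>"] by (simp add: power_abs del: power_Suc)
    then show ?thesis by (simp add: K_def abs_le_iff del: power_Suc)
  qed
  have "compact K" by (simp add: K_def)
  have opn: "open {zr. 0 < phi_poly q (snd zr) (fst zr)}"
    by (rule open_Collect_less[OF continuous_on_const continuous_on_phi_poly])
  have sub: "{x0} \<times> K \<subseteq> {zr. 0 < phi_poly q (snd zr) (fst zr)}"
  proof -
    have "0 < phi_poly q r x0" if "r \<in> K" for r
      unfolding x0_def phi_poly_endpoint[OF x]
      using that s q by (intro mult_pos_pos zero_less_power) (auto simp: K_def)
    then show ?thesis by (simp add: subset_iff mem_Times_iff del: split_paired_All)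
  qed
  obtain X0 where X0: "x0 \<in> X0" "open X0"
      "X0 \<times> K \<subseteq> {zr. 0 < phi_poly q (snd zr) (fst zr)}"
    using Elementary_Topology.tube_lemma[OF \<open>compact K\<close> opn sub] by (elim exE conjE)
  then obtain d where d: "0 < d" "cball x0 d \<subseteq> X0"
    using open_contains_cball by blast
  define A where "A = cball x0 d"
  have "compact A" by (simp add: A_def)
  have pos: "0 < phi_poly q r z" if "z \<in> A" "r \<in> K" for z r
  proof -
    have "(z, r) \<in> X0 \<times> K" using d(2) that unfolding A_def by blast
    from subsetD[OF X0(3) this] show ?thesis by simp
  qed
  have "continuous_on (A \<times> K) (\<lambda>zr. psi_minus_phi_over_r q (snd zr) (fst zr) / phi_poly q (snd zr) (fst zr))"
    using continuous_on_subset[OF continuous_on_phi_poly[of q], of "A \<times> K"]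
      continuous_on_subset[OF continuous_on_psi_minus_phi_over_r[of q], of "A \<times> K"] pos
    by (intro continuous_on_divide) (auto simp: less_le)
  then have "bounded ((\<lambda>zr. psi_minus_phi_over_r q (snd zr) (fst zr) / phi_poly q (snd zr) (fst zr)) ` (A \<times> K))"
    using \<open>compact A\<close> \<open>compact K\<close>
    by (intro compact_imp_bounded compact_continuous_image compact_Times)
  then obtain C where C: "\<And>z r. z \<in> A \<Longrightarrow> r \<in> K \<Longrightarrow> \<bar>psi_minus_phi_over_r q r z / phi_poly q r z\<bar> \<le> C"
    unfolding bounded_iff by fastforce
  define f where "f k z = (case z of (t1, t2, y1, y2) \<Rightarrow>
      psi_star q (Suc k) t1 t2 y2 / phi_star q (Suc k) t1 t2 y1 y2)" for k z
  have f_eq: "f k z = 1 + q ^ Suc k * (psi_minus_phi_over_r q (q ^ Suc k) z / phi_poly q (q ^ Suc k) z)"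
    if "z \<in> A" for k z
  proof -
    obtain t1 t2 y1 y2 where z: "z = (t1, t2, y1, y2)" by (cases z) auto
    have "phi_poly q (q ^ Suc k) (t1, t2, y1, y2) \<noteq> 0"
      using pos[OF that pow[of k]] z by simp
    then show ?thesis
      unfolding f_def z prod.case
      unfolding phi_star_eq_poly psi_star_eq_poly[where ?y1.0 = y1]
      by (simp add: add_divide_distrib del: power_Suc)
  qed
  have f_bound: "norm (f k z - 1) \<le> C * \<bar>q\<bar> ^ Suc k" if "z \<in> A" for k z
  proof -
    have "norm (f k z - 1) = \<bar>q\<bar> ^ Suc k * \<bar>psi_minus_phi_over_r q (q ^ Suc k) z / phi_poly q (q ^ Suc k) z\<bar>"
      unfolding f_eq[OF that] by (simp add: abs_mult power_abs del: power_Suc)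
    also have "\<dots> \<le> \<bar>q\<bar> ^ Suc k * C"
      by (intro mult_left_mono C that pow) auto
    finally show ?thesis by (simp add: mult.commute)
  qed
  have sum: "summable (\<lambda>k. C * \<bar>q\<bar> ^ Suc k)"
    using q by (intro summable_mult) (simp add: summable_Suc_iff summable_geometric del: power_Suc)
  have f_cont: "continuous_on A (f k)" for k
  proof -
    have "phi_star q (Suc k) t1 t2 y1 y2 \<noteq> 0" if "(t1, t2, y1, y2) \<in> A" for t1 t2 y1 y2
      unfolding phi_star_eq_poly using pos[OF that pow[of k]] by simp
    then show ?thesis
      unfolding f_def case_prod_beta psi_star_def
      by (intro continuous_on_divide) 
         (auto simp: phi_star_def intro!: continuous_intros simp del: power_Suc)
  qed
  have "uniform_limit A (\<lambda>N z. \<Sum>k<N. norm (f k z - 1)) (\<lambda>z. \<Sum>k. norm (f k z - 1)) sequentially"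
    using f_bound by (intro Weierstrass_m_test[OF _ sum]) auto
  then have "uniformly_convergent_on A (\<lambda>N z. \<Sum>k<N. norm (f k z - 1))"
    by (auto simp: uniformly_convergent_on_def)
  then have "uniformly_convergent_on A (\<lambda>N z. \<Prod>k<N. f k z)"
    by (intro uniformly_convergent_on_prod' f_cont \<open>compact A\<close>)
  then obtain L where L: "uniform_limit A (\<lambda>N z. \<Prod>k<N. f k z) L sequentially"
    by (auto simp: uniformly_convergent_on_def)
  have L_eq: "L z = (\<Prod>k. f k z)" if "z \<in> A" for z
  proof -
    have "summable (\<lambda>k. norm (f k z - 1))"
      by (rule summable_comparison_test'[OF sum, of 0]) (use f_bound[OF that] in auto)
    then have "convergent_prod (\<lambda>k. f k z)"
      by (intro abs_convergent_prod_imp_convergent_prod summable_imp_abs_convergent_prod)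
    from convergent_prod_LIMSEQ[OF this] have "(\<lambda>N. \<Prod>k<N. f k z) \<longlonglongrightarrow> (\<Prod>k. f k z)"
      by (simp add: LIMSEQ_lessThan_iff_atMost)
    with tendsto_uniform_limitI[OF L that] show ?thesis
      by (rule LIMSEQ_unique)
  qed
  have x0A: "x0 \<in> A" using d by (simp add: A_def)
  have "(\<Prod>k<N. f k x0) = (1 - q ^ Suc N) / (1 - q)" for N
  proof (induction N)
    case 0
    then show ?case using q by simp
  next
    case (Suc N)
    have "q ^ Suc N \<noteq> 1" using pow[of N] q by (auto simp: K_def)
    moreover have "f N x0 = (s\<^sup>2 * (1 - q ^ Suc N) ^ 3 * (1 - q ^ Suc (Suc N))) / (s\<^sup>2 * (1 - q ^ Suc N) ^ 4)"
      by (simp add: f_def x0_def psi_star_endpoint[OF x] phi_star_eq_poly phi_poly_endpoint[OF x] del: power_Suc)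
    moreover have "(s\<^sup>2 * c ^ 3 * d) / (s\<^sup>2 * c ^ 4) = d / c" if "c \<noteq> 0" for c d :: real
      using s that by (simp add: field_simps eval_nat_numeral)
    ultimately have "f N x0 = (1 - q ^ Suc (Suc N)) / (1 - q ^ Suc N)"
      by (simp del: power_Suc)
    then show ?case
      using Suc.IH \<open>q ^ Suc N \<noteq> 1\<close> by (simp del: power_Suc)
  qed
  moreover have "(\<lambda>N. (1 - q ^ Suc N) / (1 - q)) \<longlonglongrightarrow> (1 - 0) / (1 - q)"
    using q by (intro tendsto_intros LIMSEQ_Suc LIMSEQ_power_zero) auto
  ultimately have Lx0: "L x0 = 1 / (1 - q)"
    using tendsto_uniform_limitI[OF L x0A] LIMSEQ_unique by fastforce
  have contL: "continuous_on A L"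
    by (rule uniform_limit_theorem[OF _ L]) (auto intro!: always_eventually continuous_on_prod f_cont)
  have Z: "((\<lambda>e. (T1 e, T2 e, Y1 e, Y2 e)) \<longlongrightarrow> x0) F"
    unfolding x0_def by (intro tendsto_Pair T1 T2 Y1 Y2)
  have ev: "eventually (\<lambda>e. (T1 e, T2 e, Y1 e, Y2 e) \<in> A) F"
    using topological_tendstoD[OF Z open_ball, of x0 d] d(1)
    by (auto simp: A_def elim!: eventually_mono intro: less_imp_le)
  have "((\<lambda>e. L (T1 e, T2 e, Y1 e, Y2 e)) \<longlongrightarrow> 1 / (1 - q)) F"
    using continuous_on_tendsto_compose[OF contL Z x0A ev] Lx0 by simp
  moreover have "eventually (\<lambda>e. L (T1 e, T2 e, Y1 e, Y2 e) = (\<Prod>k. psi_star q (Suc k) (T1 e) (T2 e) (Y2 e)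
             / phi_star q (Suc k) (T1 e) (T2 e) (Y1 e) (Y2 e))) F"
    using ev by eventually_elim (simp add: L_eq f_def)
  ultimately show ?thesis
    by (rule Lim_transform_eventually)
qed

text \<open>The factor with \<open>k = 0\<close> vanishes at the end-point, and to a high order along the
  scaling of the theorem. The position \<open>- 2 * s * a\<close> of the end-point and the relation
  \<open>a\<^sup>2 * (s * (1 - q)) = 1\<close> make the terms in \<open>e\<^sup>2\<close> and
  \<open>e ^ 3\<close> cancel, and the coefficient of \<open>e ^ 4\<close> is, up to the factor
  \<open>1 / s\<^sup>2\<close>, the polynomial in the denominator of the Biane density.\<close>

lemma phi_star_0_rescaled:
  fixes a s q e u1 u2 z1 z2 :: real
  assumes a: "a\<^sup>2 * (s * (1 - q)) = 1"
  defines "y1 \<equiv> - 2 * s * a - a * u1 * e + a / s * e\<^sup>2 * z1"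
    and "y2 \<equiv> - 2 * s * a - a * u2 * e + a / s * e\<^sup>2 * z2"
  shows "phi_star q 0 (s + u1 * e) (s + u2 * e) y1 y2 =
     e ^ 4 / s\<^sup>2 * ((z2 - z1)\<^sup>2 - (u2 - u1) * (u1 * z2 - u2 * z1) + e * (z2 - z1) * (u1 * z2 - u2 * z1) / s)"
proof -
  have s: "s \<noteq> 0" using a by auto
  have qa: "(1 - q) * a\<^sup>2 = 1 / s" using a s by (simp add: field_simps)
  define w1 where "w1 = - 2 * s - u1 * e + e\<^sup>2 * z1 / s"
  define w2 where "w2 = - 2 * s - u2 * e + e\<^sup>2 * z2 / s"
  have y: "y1 = a * w1" "y2 = a * w2"
    by (simp_all add: y1_def y2_def w1_def w2_def algebra_simps)
  have "phi_star q 0 (s + u1 * e) (s + u2 * e) y1 y2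
     = ((u2 - u1) * e)\<^sup>2 + ((1 - q) * a\<^sup>2) * ((w2 - w1) * ((s + u1 * e) * w2 - (s + u2 * e) * w1))"
    unfolding phi_star_def y by simp algebra
  also have "\<dots> = ((u2 - u1) * e)\<^sup>2 + ((w2 - w1) * ((s + u1 * e) * w2 - (s + u2 * e) * w1)) / s"
    by (simp add: qa)
  also have "\<dots> = e ^ 4 / s\<^sup>2 * ((z2 - z1)\<^sup>2 - (u2 - u1) * (u1 * z2 - u2 * z1) + e * (z2 - z1) * (u1 * z2 - u2 * z1) / s)"
    using s unfolding w1_def w2_def by (simp add: field_simps eval_nat_numeral)
  finally show ?thesis .
qed

text \<open>The end-point cancels the term of order \<open>1\<close>, the drift \<open>a\<close> the term of
  order \<open>e\<close>. The sign
  of the leading coefficient turns the support of the q-Brownian motion into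
  \<open>z \<ge> u\<^sup>2 / 4\<close>.\<close>

lemma radicand_rescaled:
  fixes a s q e u z :: real
  assumes a: "a\<^sup>2 * (s * (1 - q)) = 1"
  shows "4 * (s + u * e) - (1 - q) * (- 2 * s * a - a * u * e + a / s * e\<^sup>2 * z)\<^sup>2 =
     e\<^sup>2 * ((4 * z - u\<^sup>2) / s + e * (2 * u * z / s\<^sup>2) - e\<^sup>2 * (z\<^sup>2 / s ^ 3))"
proof -
  have s: "s \<noteq> 0" using a by auto
  have qa: "(1 - q) * a\<^sup>2 = 1 / s" using a s by (simp add: field_simps)
  have "- 2 * s * a - a * u * e + a / s * e\<^sup>2 * z = a * (- 2 * s - u * e + e\<^sup>2 * z / s)"
    by (simp add: algebra_simps)
  then have "4 * (s + u * e) - (1 - q) * (- 2 * s * a - a * u * e + a / s * e\<^sup>2 * z)\<^sup>2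
     = 4 * (s + u * e) - ((1 - q) * a\<^sup>2) * (- 2 * s - u * e + e\<^sup>2 * z / s)\<^sup>2"
    by (simp add: power_mult_distrib)
  also have "\<dots> = 4 * (s + u * e) - (- 2 * s - u * e + e\<^sup>2 * z / s)\<^sup>2 / s"
    by (simp add: qa)
  also have "\<dots> = e\<^sup>2 * ((4 * z - u\<^sup>2) / s + e * (2 * u * z / s\<^sup>2) - e\<^sup>2 * (z\<^sup>2 / s ^ 3))"
    using s by (simp add: field_simps eval_nat_numeral)
  finally show ?thesis .
qed

text \<open>Counting powers of \<open>e\<close>: \<open>e\<^sup>2\<close> from the change of variables,
  \<open>e\<close> from \<open>t2 - t1\<close> and \<open>e\<close> from the square root cancel \<open>e ^ 4\<close> in
  the denominator. The space unit \<open>a / s\<close> is the constant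
  \<open>1 / (s powr (3/2) * sqrt (1 - q))\<close>.\<close>

lemma qBM_density_rescaled_tendsto:
  fixes a s q u1 u2 z1 z2 :: real
  assumes q: "\<bar>q\<bar> < 1" and s: "0 < s" and a: "0 < a" "a\<^sup>2 * (s * (1 - q)) = 1"
    and u: "u1 < u2" and pos: "0 < biane_density u1 u2 z1 z2"
  defines "Y \<equiv> \<lambda>e u z. - 2 * s * a - a * u * e + a / s * e\<^sup>2 * z"
  shows "((\<lambda>e. a / s * e\<^sup>2 * qBM_density q (s + u1 * e) (s + u2 * e) (Y e u1 z1) (Y e u2 z2))
     \<longlongrightarrow> biane_density u1 u2 z1 z2) (at_right 0)"
proof -
  \<comment> \<open>\<open>D\<close> is the denominator of the Biane density, \<open>D'\<close> and \<open>R\<close> are the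
      rescaled \<open>phi_star q 0\<close> and radicand, \<open>Pr\<close> is the infinite product.\<close>
  define B where "B = u1 * z2 - u2 * z1"
  define D where "D = (z2 - z1)\<^sup>2 - (u2 - u1) * B"
  define D' where "D' e = D + e * (z2 - z1) * B / s" for e
  define R where "R e = (4 * z2 - u2\<^sup>2) / s + e * (2 * u2 * z2 / s\<^sup>2) - e\<^sup>2 * (z2\<^sup>2 / s ^ 3)" for e
  define Pr where "Pr e = (\<Prod>k. psi_star q (Suc k) (s + u1 * e) (s + u2 * e) (Y e u2 z2)
             / phi_star q (Suc k) (s + u1 * e) (s + u2 * e) (Y e u1 z1) (Y e u2 z2))" for e
  have z2: "u2\<^sup>2 / 4 < z2"
    using pos by (auto simp: biane_density_def split: if_splits)
  have bd: "biane_density u1 u2 z1 z2 = (u2 - u1) * sqrt (4 * z2 - u2\<^sup>2) / (2 * pi * D)"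
    using z2 by (simp add: biane_density_def D_def B_def)
  have D: "0 < D"
  proof -
    have "0 < (u2 - u1) * sqrt (4 * z2 - u2\<^sup>2)" using u z2 by simp
    with pos have "0 < 2 * pi * D" unfolding bd by (metis zero_less_divide_iff less_asym)
    then show ?thesis by (simp add: zero_less_mult_iff)
  qed
  have lim_id: "((\<lambda>e::real. e) \<longlongrightarrow> 0) (at_right 0)" by simp
  have R: "(R \<longlongrightarrow> (4 * z2 - u2\<^sup>2) / s) (at_right 0)"
    unfolding R_def by (rule tendsto_eq_intros lim_id | simp)+
  have D': "(D' \<longlongrightarrow> D) (at_right 0)"
    unfolding D'_def by (rule tendsto_eq_intros lim_id | use s in simp)+
  have x: "(1 - q) * (- 2 * s * a)\<^sup>2 = 4 * s"
  proof -
    have "(1 - q) * (- 2 * s * a)\<^sup>2 = 4 * s * (a\<^sup>2 * (s * (1 - q)))" by algebra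
    then show ?thesis by (simp add: a)
  qed
  have T: "((\<lambda>e. s + u * e) \<longlongrightarrow> s) (at_right 0)" for u
    by (rule tendsto_eq_intros lim_id | simp)+
  have YT: "((\<lambda>e. Y e u z) \<longlongrightarrow> - 2 * s * a) (at_right 0)" for u z
    unfolding Y_def by (rule tendsto_eq_intros lim_id | use s in simp)+
  have Pr: "(Pr \<longlongrightarrow> 1 / (1 - q)) (at_right 0)"
    unfolding Pr_def by (rule qBM_product_tendsto[OF q s x T T YT YT])
  have q1: "0 < 1 - q" using q by simp
  have Rpos: "0 < (4 * z2 - u2\<^sup>2) / s" using z2 s by simp
  have "eventually (\<lambda>e. 0 < R e) (at_right 0)"
    using order_tendstoD(1)[OF R Rpos] .
  moreover have "eventually (\<lambda>e. 0 < s + u2 * e) (at_right 0)"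
    using order_tendstoD(1)[OF T s] .
  moreover have "eventually (\<lambda>e::real. 0 < e) (at_right 0)"
    by (simp add: eventually_at_right_less)
  ultimately have "eventually (\<lambda>e. a * s * ((1 - q) powr (3/2)) * (u2 - u1) / (2 * pi) * (sqrt (R e) / D' e) * Pr e
      = a / s * e\<^sup>2 * qBM_density q (s + u1 * e) (s + u2 * e) (Y e u1 z1) (Y e u2 z2)) (at_right 0)"
  proof eventually_elim
    fix e :: real assume e: "0 < R e" "0 < s + u2 * e" "0 < e"
    have rad: "4 * (s + u2 * e) - (1 - q) * (Y e u2 z2)\<^sup>2 = e\<^sup>2 * R e"
      unfolding Y_def R_def by (rule radicand_rescaled[OF a(2)])
    have "(Y e u2 z2)\<^sup>2 \<le> 4 * ((s + u2 * e) / (1 - q))"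
    proof -
      have "0 \<le> e\<^sup>2 * R e" using e by simp
      then have "(Y e u2 z2)\<^sup>2 * (1 - q) \<le> 4 * (s + u2 * e)" using rad by (simp add: mult.commute)
      then show ?thesis using q1 by (simp add: pos_le_divide_eq)
    qed
    then have "\<bar>Y e u2 z2\<bar> \<le> sqrt 4 * sqrt ((s + u2 * e) / (1 - q))"
      by (metis real_sqrt_abs real_sqrt_le_mono real_sqrt_mult)
    then have supp: "Y e u2 z2 \<in> qBM_support q (s + u2 * e)"
      by (auto simp add: qBM_support_def abs_le_iff)
    have phi0: "phi_star q 0 (s + u1 * e) (s + u2 * e) (Y e u1 z1) (Y e u2 z2) = e ^ 4 / s\<^sup>2 * D' e"
      unfolding Y_def phi_star_0_rescaled[OF a(2)] by (simp add: D'_def D_def B_def)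
    have "qBM_density q (s + u1 * e) (s + u2 * e) (Y e u1 z1) (Y e u2 z2)
      = (1 - q) powr (3/2) * ((u2 - u1) * e) / (2 * pi) * (e * sqrt (R e) / (e ^ 4 / s\<^sup>2 * D' e)) * Pr e"
      using supp e(3) unfolding qBM_density_def phi0 rad Pr_def
      by (simp add: real_sqrt_mult left_diff_distrib)
    then show "a * s * ((1 - q) powr (3/2)) * (u2 - u1) / (2 * pi) * (sqrt (R e) / D' e) * Pr e
      = a / s * e\<^sup>2 * qBM_density q (s + u1 * e) (s + u2 * e) (Y e u1 z1) (Y e u2 z2)"
      using e(3) s by (simp add: eval_nat_numeral ac_simps)
  qed
  moreover have "((\<lambda>e. a * s * ((1 - q) powr (3/2)) * (u2 - u1) / (2 * pi) * (sqrt (R e) / D' e) * Pr e)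
     \<longlongrightarrow> a * s * ((1 - q) powr (3/2)) * (u2 - u1) / (2 * pi)
        * (sqrt ((4 * z2 - u2\<^sup>2) / s) / D) * (1 / (1 - q))) (at_right 0)"
    by (intro tendsto_intros R D' Pr) (use D in auto)
  moreover have "a * s * ((1 - q) powr (3/2)) * (u2 - u1) / (2 * pi)
        * (sqrt ((4 * z2 - u2\<^sup>2) / s) / D) * (1 / (1 - q)) = biane_density u1 u2 z1 z2"
  proof -
    have "(a * (sqrt s * sqrt (1 - q)))\<^sup>2 = 1\<^sup>2"
      using a(2) s q1 by (simp add: power_mult_distrib)
    moreover have "0 \<le> a * (sqrt s * sqrt (1 - q))"
      using a(1) s q1 by simp
    ultimately have asq: "a * (sqrt s * sqrt (1 - q)) = 1"
      by (rule power2_eq_imp_eq[OF _ _ zero_le_one])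
    have pw: "(1 - q) powr (3/2) = (1 - q) * sqrt (1 - q)"
      using q1 powr_add[of "1 - q" 1 "1/2"] by (simp add: powr_half_sqrt)
    have "a * s * ((1 - q) powr (3/2)) * (u2 - u1) / (2 * pi)
        * (sqrt ((4 * z2 - u2\<^sup>2) / s) / D) * (1 / (1 - q))
      = (a * s * sqrt (1 - q) / sqrt s) * ((u2 - u1) * sqrt (4 * z2 - u2\<^sup>2) / (2 * pi * D))"
      using q1 by (simp add: pw real_sqrt_divide ac_simps)
    also have "a * s * sqrt (1 - q) / sqrt s = a * ((s / sqrt s) * sqrt (1 - q))"
      by simp
    also have "\<dots> = 1"
      using asq s by (simp add: real_div_sqrt)
    finally show ?thesis by (simp add: bd)
  qed
  ultimately show ?thesis
    using Lim_transform_eventually by force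
qed

section \<open>Convergence to the Biane process\<close>

lemma integral_fin_dim_distr:
  fixes f :: "real ^ 'n \<Rightarrow> real"
  assumes "\<And>i. X (t $ i) \<in> borel_measurable M" "f \<in> borel_measurable borel"
  shows "integral\<^sup>L (fin_dim_distr M X t) f = (\<integral>\<omega>. f (\<chi> i. X (t $ i) \<omega>) \<partial>M)"
  unfolding fin_dim_distr_def by (rule integral_distr[OF borel_measurable_vec_lambda assms(2)]) (rule assms(1))

theorem proposition2p6:
  fixes q s x_minus a :: real
    and M :: "'a measure" and W :: "real \<Rightarrow> 'a \<Rightarrow> real"
    and N :: "'b measure" and Z :: "real \<Rightarrow> 'b \<Rightarrow> real"
    and t :: "real ^ 'n"
  assumes "-1 < q" and "q < 1" and "s > 0"
    and "x_minus = - 2 * sqrt (s / (1 - q))"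
    and "a = - 2 / ((1 - q) * x_minus)"
    and "q_Brownian_motion_from q s x_minus M W"
    and "biane_process N Z"
    and "\<forall>i. t $ i \<ge> 0"
  shows "a = 1 / sqrt (s * (1 - q)) \<and>
         weakly_converges (\<lambda>\<epsilon>. fin_dim_distr M (V_tilde s a W \<epsilon>) t)
           (fin_dim_distr N (\<lambda>u \<omega>. 1 / (s powr (3/2) * sqrt (1 - q)) * Z u \<omega>) t)
           (at_right 0)"
proof -
  have q: "\<bar>q\<bar> < 1" and q1: "0 < 1 - q" and s: "0 < s" and t: "\<And>i. 0 \<le> t $ i"
    using assms by auto
  have W: "markov_process_from (qBM_density q) s x_minus M W"
    using assms(6) by (simp add: q_Brownian_motion_from_def)
  have Z: "markov_process_from biane_density 0 0 N Z"
    using assms(7) by (simp add: biane_process_def)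
  have a: "a = 1 / sqrt (s * (1 - q))"
    using assms(5) q1 s unfolding assms(4)
    by (simp add: real_sqrt_mult real_sqrt_divide) (simp add: field_simps)
  have a0: "0 < a" using a s q1 by simp
  have a2: "a\<^sup>2 * (s * (1 - q)) = 1"
    using s q1 by (simp add: a power_divide)
  have x: "x_minus = - 2 * s * a"
  proof -
    have "s * a = (s / sqrt s) / sqrt (1 - q)" by (simp add: a real_sqrt_mult)
    also have "\<dots> = sqrt (s / (1 - q))" using s by (simp add: real_div_sqrt real_sqrt_divide)
    finally show ?thesis by (simp add: assms(4))
  qed
  have c: "1 / (s powr (3/2) * sqrt (1 - q)) = a / s"
    using s powr_add[of s 1 "1/2"] by (simp add: a powr_half_sqrt real_sqrt_mult)
  have "((\<lambda>\<epsilon>. integral\<^sup>L (fin_dim_distr M (V_tilde s a W \<epsilon>) t) f) \<longlongrightarrow>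
      integral\<^sup>L (fin_dim_distr N (\<lambda>u \<omega>. a / s * Z u \<omega>) t) f) (at_right 0)"
    if f: "continuous_on UNIV f" "bounded (range f)" for f :: "real ^ 'n \<Rightarrow> real"
  proof -
    obtain C where C: "\<And>v. \<bar>f v\<bar> \<le> C"
      using f(2) by (auto simp: bounded_iff)
    have fm [measurable]: "f \<in> borel_measurable borel"
      using f(1) by (rule borel_measurable_continuous_onI)
    define g where "g v = f (\<chi> i. a / s * v $ i)" for v
    have g: "g \<in> borel_measurable borel"
    proof -
      have "continuous_on UNIV (\<lambda>v::real ^ 'n. \<chi> i. a / s * v $ i)"
        by (intro continuous_intros)
      then show ?thesis
        unfolding g_def by (intro measurable_compose[OF borel_measurable_continuous_onI fm])
    qed
    have Zint: "integral\<^sup>L (fin_dim_distr N (\<lambda>u \<omega>. a / s * Z u \<omega>) t) f = (\<integral>\<omega>. g (\<chi> i. Z (t $ i) \<omega>) \<partial>N)"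
    proof -
      have [measurable]: "Z (t $ i) \<in> borel_measurable N" for i
        using Z t[of i] by (auto simp: markov_process_from_def)
      have "integral\<^sup>L (fin_dim_distr N (\<lambda>u \<omega>. a / s * Z u \<omega>) t) f
          = (\<integral>\<omega>. f (\<chi> i. a / s * Z (t $ i) \<omega>) \<partial>N)"
        by (rule integral_fin_dim_distr) measurable
      then show ?thesis by (simp add: g_def)
    qed
    \<comment> \<open>\<open>Y\<close> is \<open>V_tilde\<close> in units of \<open>a / s\<close>, with \<open>W s\<close> replaced by its
        almost sure value \<open>- 2 * s * a\<close>: then \<open>Y e\<close> is an affine image of
        \<open>W\<close> with a deterministic shift.\<close>
    define b where "b e u = - 2 * s * a - a * u * e" for e u
    define d where "d e = a / s * e\<^sup>2" for e
    define Y where "Y e u \<omega> = (W (s + u * e) \<omega> - b e u) / d e" for e u \<omega>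
    have Wint: "integral\<^sup>L (fin_dim_distr M (V_tilde s a W e) t) f = (\<integral>\<omega>. g (\<chi> i. Y e (t $ i) \<omega>) \<partial>M)"
      if e: "0 < e" for e
    proof -
      have [measurable]: "W (s + t $ i * e) \<in> borel_measurable M" "W s \<in> borel_measurable M" for i
        using W t[of i] e by (auto simp: markov_process_from_def)
      have [measurable]: "V_tilde s a W e (t $ i) \<in> borel_measurable M"
           "Y e (t $ i) \<in> borel_measurable M" for i
        unfolding V_tilde_def[abs_def] Y_def[abs_def] by measurable
      have "integral\<^sup>L (fin_dim_distr M (V_tilde s a W e) t) f = (\<integral>\<omega>. f (\<chi> i. V_tilde s a W e (t $ i) \<omega>) \<partial>M)"
        by (rule integral_fin_dim_distr) measurable
      also have "\<dots> = (\<integral>\<omega>. g (\<chi> i. Y e (t $ i) \<omega>) \<partial>M)"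
      proof (rule integral_cong_AE)
        have "AE \<omega> in M. W s \<omega> = x_minus"
          using W by (simp add: markov_process_from_def)
        then show "AE \<omega> in M. f (\<chi> i. V_tilde s a W e (t $ i) \<omega>) = g (\<chi> i. Y e (t $ i) \<omega>)"
        proof eventually_elim
          case (elim \<omega>)
          have "V_tilde s a W e u \<omega> = a / s * Y e u \<omega>" for u
            using elim a0 s e by (simp add: V_tilde_def Y_def b_def d_def x field_simps)
          then show ?case by (simp add: g_def)
        qed
      qed (auto intro!: measurable_compose[OF borel_measurable_vec_lambda fm]
            measurable_compose[OF borel_measurable_vec_lambda g])
      finally show ?thesis .
    qed
    show ?thesis
      unfolding Zint
    proof (rule tendsto_at_right_sequentially[of 0 1])
      fix S :: "nat \<Rightarrow> real"
      assume S: "\<And>n. 0 < S n" "S \<longlonglongrightarrow> 0"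
      have S': "filterlim S (at_right 0) sequentially"
        using S by (intro tendsto_imp_filterlim_at_right) auto
      have d0: "0 < d (S n)" for n
        using S(1)[of n] a0 s by (simp add: d_def)
      have "(\<lambda>n. \<integral>\<omega>. g (\<chi> i. Y (S n) (t $ i) \<omega>) \<partial>M) \<longlonglongrightarrow> (\<integral>\<omega>. g (\<chi> i. Z (t $ i) \<omega>) \<partial>N)"
      proof (rule fin_dim_convergence_of_transition_densities[OF _ Z _ borel_transition_biane_density _ t g])
        fix n
        show "markov_process_from (\<lambda>u1 u2 z1 z2. d (S n) * qBM_density q (s + u1 * S n) (s + u2 * S n)
              (b (S n) u1 + d (S n) * z1) (b (S n) u2 + d (S n) * z2)) 0 0 M (Y (S n))"
          unfolding Y_def[abs_def]
          by (rule markov_process_affine[OF W borel_transition_qBM_density S(1) d0]) (simp add: b_def x)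
        show "borel_transition 0 (\<lambda>u1 u2 z1 z2. d (S n) * qBM_density q (s + u1 * S n) (s + u2 * S n)
              (b (S n) u1 + d (S n) * z1) (b (S n) u2 + d (S n) * z2))"
          by (rule borel_transition_affine[OF borel_transition_qBM_density S(1)])
      next
        fix u1 u2 z1 z2 :: real
        assume "0 \<le> u1" "u1 < u2" "0 < biane_density u1 u2 z1 z2"
        from filterlim_compose[OF qBM_density_rescaled_tendsto[OF q s a0 a2 this(2,3)] S']
        show "(\<lambda>n. d (S n) * qBM_density q (s + u1 * S n) (s + u2 * S n)
              (b (S n) u1 + d (S n) * z1) (b (S n) u2 + d (S n) * z2)) \<longlonglongrightarrow> biane_density u1 u2 z1 z2"
          by (simp add: b_def d_def)
      next
        show "\<bar>g v\<bar> \<le> C" for v using C by (simp add: g_def)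
      qed
      then show "(\<lambda>n. integral\<^sup>L (fin_dim_distr M (V_tilde s a W (S n)) t) f)
          \<longlonglongrightarrow> (\<integral>\<omega>. g (\<chi> i. Z (t $ i) \<omega>) \<partial>N)"
        by (simp add: Wint S)
    qed simp
  qed
  then show ?thesis
    unfolding weakly_converges_def c using a by blast
qed

end
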